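(* Let $CP_3(n)$ be defined by $\sum_{n\ge 0} CP_3(n)q^n = \dfrac{f_3^6f_6^6}{f_1^2f_2^2}$. Then for all integers $n\ge 0$, \[ CP_3(24n+11)\equiv 0\pmod{48},\qquad CP_3(24n+23)\equiv 0\pmod{96}. \]
   Context: For $|q|<1$ and integer $m\ge 1$, $f_m := (q^m;q^m)_\infty=\prod_{n\ge1}(1-q^{mn})$. $CP_3(n)$ is the number of $3$-core cubic bipartitions of $n$, defined by the generating function $\sum_{n\ge0}CP_3(n)q^n = \frac{f_3^6f_6^6}{f_1^2f_2^2}$. *)

theory Defs
  imports "HOL-Analysis.Analysis" "HOL-Number_Theory.Cong"
begin

text \<open>
  The q-series are read as formal power series in \<open>q = fps_X\<close> over the integers; the infinite
  product is the limit of the partial products in the usual (coefficientwise) topology.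
  The index starts at 0, so that the factors are \<open>1 - q^m, 1 - q^(2m), \<dots>\<close>.
  Only \<open>m \<ge> 1\<close> is meaningful.
\<close>

definition euler_f :: "nat \<Rightarrow> int fps" where
  "euler_f m = (\<Prod>n. 1 - fps_X ^ (m * Suc n))"

lemma euler_f_has_prod:
  assumes "m \<ge> 1"
  shows "(\<lambda>n. 1 - fps_X ^ (m * Suc n) :: int fps) has_prod euler_f m"
    and "fps_nth (euler_f m) 0 = 1"
proof -
  define a where "a = (\<lambda>n. 1 - fps_X ^ (m * Suc n) :: int fps)"
  define P where "P = (\<lambda>n. \<Prod>i\<le>n. a i)"
  define L where "L = Abs_fps (\<lambda>k. fps_nth (P k) k)"
  have step: "fps_nth (P (Suc n)) k = fps_nth (P n) k" if "k \<le> n" for n k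
  proof -
    have "k < 1 * Suc (Suc n)" using that by simp
    also have "\<dots> \<le> m * Suc (Suc n)"
      using assms by (rule mult_le_mono1)
    finally have "k < m * Suc (Suc n)" .
    then show ?thesis
      by (simp add: P_def a_def algebra_simps fps_X_power_mult_nth del: mult_Suc_right)
  qed
  have stable: "fps_nth (P n) k = fps_nth L k" if "n \<ge> k" for n k
    using that by (induction n rule: dec_induct) (simp_all add: L_def step)
  have "P \<longlonglongrightarrow> L"
    by (rule tendsto_fpsI) (use stable eventually_ge_at_top in \<open>blast intro: eventually_mono\<close>)
  moreover have L0: "fps_nth L 0 = 1"
    using assms by (simp add: L_def P_def a_def)
  then have "L \<noteq> 0" by auto
  ultimately have hp: "a has_prod L"
    by (simp add: has_prod_def raw_has_prod_def P_def)
  moreover have "euler_f m = prodinf a"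
    by (simp add: euler_f_def a_def)
  ultimately have "euler_f m = L"
    by (metis has_prod_unique)
  with hp L0 show "(\<lambda>n. 1 - fps_X ^ (m * Suc n) :: int fps) has_prod euler_f m"
    and "fps_nth (euler_f m) 0 = 1"
    by (simp_all add: a_def)
qed

text \<open>
  The denominator has constant term 1, so it is invertible over the integers. Since \<open>int\<close> is not a
  field, \<^term>\<open>fps_right_inverse\<close> is used in place of division; its second argument is the inverse
  of the constant term.
\<close>

definition CP3_gf :: "int fps" where
  "CP3_gf = euler_f 3 ^ 6 * euler_f 6 ^ 6 * fps_right_inverse (euler_f 1 ^ 2 * euler_f 2 ^ 2) 1"

definition CP3 :: "nat \<Rightarrow> int" where
  "CP3 n = fps_nth CP3_gf n"

lemma CP3_gf_eq:
  "Abs_fps CP3 * (euler_f 1 ^ 2 * euler_f 2 ^ 2) = euler_f 3 ^ 6 * euler_f 6 ^ 6"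
proof -
  have "(euler_f 1 ^ 2 * euler_f 2 ^ 2) * fps_right_inverse (euler_f 1 ^ 2 * euler_f 2 ^ 2) 1 = 1"
    by (rule fps_right_inverse) (simp add: euler_f_has_prod(2) fps_nth_power_0)
  moreover have "Abs_fps CP3 = CP3_gf"
    by (simp add: fps_eq_iff CP3_def)
  ultimately show ?thesis
    by (simp add: CP3_gf_def mult.assoc mult.left_commute mult.commute)
qed

end

theory Submission
  imports Defs
begin

text \<open>
  Write \<open>\<phi>(q) = \<Sum> q^(n^2)\<close> and \<open>\<psi>(q) = \<Sum> q^(2t^2+t)\<close>, both over the integers. Gauss's product formulas
  turn \<open>f_3^3 / f_1\<close> into \<open>\<phi>(-q^3)^2 \<psi>(q) \<psi>(q^3) / f_2^2\<close>, and splitting the lattices behind these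
  theta functions into residue classes gives 2-dissections. Applied twice, they show that modulo 32
  the terms with exponents in \<open>4n + 3\<close> are those of \<open>8 q^3 f_12^6 (\<psi>(q^8)^2 - 2 q^4 \<psi>(q^12)^4)\<close>.
  As a triangular number is 0 or 1 modulo 3, in the class \<open>12n + 11\<close> only the doubled cross term of
  \<open>\<psi>(q^8)^2\<close> survives, and since \<open>f_12^2 \<equiv> f_24\<close> modulo 2 it contributes modulo 32 only to \<open>24n + 11\<close>.

  Modulo 3 the generating function is \<open>f_3^5 f_6^5 \<phi>(-q) \<psi>(q)\<close>. Its terms with exponents in \<open>3n + 2\<close>
  are governed by \<open>\<Sum> (-1)^(a+b) q^(a^2+3b^2)\<close> with \<open>a \<equiv> 1\<close> modulo 3; for even exponents this
  counts Eisenstein integers of given norm, which come in orbits of size 3 under the cube roots of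
  unity.
\<close>

section \<open>Generating series of weighted sets\<close>

text \<open>Exponents are integer-valued so that lattices can be reindexed by integer substitutions.
  Points of negative exponent contribute to no coefficient, and an infinite fibre would give 0 by
  the convention for sums over infinite sets.\<close>

definition gser :: "'a set \<Rightarrow> ('a \<Rightarrow> int) \<Rightarrow> ('a \<Rightarrow> int) \<Rightarrow> int fps" where
  "gser A w e = Abs_fps (\<lambda>k. \<Sum>x | x \<in> A \<and> e x = int k. w x)"

text \<open>This is the condition under which the formal sum converges coefficientwise and two such
  sums may be multiplied. Asking for finite sublevel sets instead of finite fibres lets the
  condition pass directly to Cartesian products.\<close>

definition loc_fin :: "'a set \<Rightarrow> ('a \<Rightarrow> int) \<Rightarrow> bool" where
  "loc_fin A e \<longleftrightarrow> (\<forall>x\<in>A. 0 \<le> e x) \<and> (\<forall>k. finite {x \<in> A. e x \<le> k})"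

lemma loc_fin_subset: "loc_fin B e \<Longrightarrow> A \<subseteq> B \<Longrightarrow> loc_fin A e"
  unfolding loc_fin_def
proof (intro conjI allI)
  fix k
  assume B: "(\<forall>x\<in>B. 0 \<le> e x) \<and> (\<forall>k. finite {x \<in> B. e x \<le> k})" and "A \<subseteq> B"
  then show "\<forall>x\<in>A. 0 \<le> e x" by blast
  have "finite {x \<in> B. e x \<le> k}"
    using B by blast
  moreover have "{x \<in> A. e x \<le> k} \<subseteq> {x \<in> B. e x \<le> k}"
    using \<open>A \<subseteq> B\<close> by blast
  ultimately show "finite {x \<in> A. e x \<le> k}"
    by (rule rev_finite_subset)
qed

lemma loc_fin_fibre: "loc_fin A e \<Longrightarrow> finite {x \<in> A. e x = k}"
  unfolding loc_fin_def by (rule finite_subset[of _ "{x \<in> A. e x \<le> k}"]) auto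

lemma loc_finI_abs:
  fixes e :: "int \<Rightarrow> int"
  assumes "\<And>n. \<bar>n\<bar> \<le> e n"
  shows "loc_fin A e"
proof -
  have "finite {n \<in> A. e n \<le> k}" for k
  proof (rule finite_subset)
    show "{n \<in> A. e n \<le> k} \<subseteq> {-k..k}"
    proof
      fix n assume "n \<in> {n \<in> A. e n \<le> k}"
      with assms[of n] have "\<bar>n\<bar> \<le> k" by simp
      then show "n \<in> {-k..k}" by auto
    qed
  qed simp
  moreover have "0 \<le> e n" for n
    using assms[of n] by linarith
  ultimately show ?thesis
    by (simp add: loc_fin_def)
qed

lemma loc_fin_Times:
  assumes "loc_fin A e" "loc_fin B e'"
  shows "loc_fin (A \<times> B) (\<lambda>(x, y). e x + e' y)"
proof -
  have "finite {p \<in> A \<times> B. (case p of (x, y) \<Rightarrow> e x + e' y) \<le> k}" for k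
  proof (rule finite_subset)
    show "{p \<in> A \<times> B. (case p of (x, y) \<Rightarrow> e x + e' y) \<le> k} \<subseteq>
        {x \<in> A. e x \<le> k} \<times> {y \<in> B. e' y \<le> k}"
      using assms unfolding loc_fin_def by fastforce
    show "finite ({x \<in> A. e x \<le> k} \<times> {y \<in> B. e' y \<le> k})"
      using assms unfolding loc_fin_def by blast
  qed
  then show ?thesis
    using assms by (auto simp: loc_fin_def)
qed

lemma gser_nth: "fps_nth (gser A w e) k = (\<Sum>x | x \<in> A \<and> e x = int k. w x)"
  by (simp add: gser_def)

lemma gser_reindex:
  assumes "inj_on h A" "B = h ` A"
    and "\<And>x. x \<in> A \<Longrightarrow> e' (h x) = e x" "\<And>x. x \<in> A \<Longrightarrow> w' (h x) = w x"
  shows "gser B w' e' = gser A w e"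
proof (rule fps_ext)
  fix k
  have "{x \<in> B. e' x = int k} = h ` {x \<in> A. e x = int k}"
    using assms by auto
  moreover have "inj_on h {x \<in> A. e x = int k}"
    using assms(1) by (rule inj_on_subset) auto
  ultimately show "fps_nth (gser B w' e') k = fps_nth (gser A w e) k"
    using assms by (auto simp: gser_nth sum.reindex)
qed

lemma gser_reindex_inverse:
  assumes "\<And>x. x \<in> A \<Longrightarrow> h x \<in> B \<and> g (h x) = x \<and> e' (h x) = e x \<and> w' (h x) = w x"
    and "\<And>y. y \<in> B \<Longrightarrow> g y \<in> A \<and> h (g y) = y"
  shows "gser B w' e' = gser A w e"
proof (rule gser_reindex)
  show "inj_on h A"
    using assms(1) by (intro inj_on_inverseI[of _ g]) auto
  show "B = h ` A"
    using assms by (force simp: image_iff)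
qed (use assms(1) in auto)

lemma gser_Un:
  assumes "loc_fin (A \<union> B) e" "A \<inter> B = {}"
  shows "gser (A \<union> B) w e = gser A w e + gser B w e"
proof (rule fps_ext)
  fix k
  have "{x \<in> A \<union> B. e x = int k} = {x \<in> A. e x = int k} \<union> {x \<in> B. e x = int k}"
    by auto
  moreover have "finite {x \<in> A. e x = int k}" "finite {x \<in> B. e x = int k}"
    using assms(1) by (auto intro!: loc_fin_fibre elim: loc_fin_subset)
  ultimately show "fps_nth (gser (A \<union> B) w e) k = fps_nth (gser A w e + gser B w e) k"
    using assms(2) by (simp add: gser_nth sum.union_disjoint disjoint_iff)
qed

lemma gser_split:
  assumes "loc_fin A e"
  shows "gser A w e = gser {x \<in> A. P x} w e + gser {x \<in> A. \<not> P x} w e"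
proof -
  have "A = {x \<in> A. P x} \<union> {x \<in> A. \<not> P x}" by auto
  then show ?thesis
    using gser_Un[of "{x \<in> A. P x}" "{x \<in> A. \<not> P x}" e w] assms by (metis (no_types, lifting) disjoint_iff mem_Collect_eq)
qed

lemma gser_add: "gser A w e + gser A w' e = gser A (\<lambda>x. w x + w' x) e"
  by (rule fps_ext) (simp add: gser_nth sum.distrib)

lemma gser_const: "of_int c * gser A w e = gser A (\<lambda>x. c * w x) e"
proof -
  have "of_int c = fps_const c" using fps_of_int[of c, where ?'a = int] by simp
  then show ?thesis by (intro fps_ext) (simp add: gser_nth sum_distrib_left)
qed

lemma gser_eq_0: "(\<And>x. x \<in> A \<Longrightarrow> w x = 0) \<Longrightarrow> gser A w e = 0"
  by (rule fps_ext) (simp add: gser_nth)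

lemma gser_X_power:
  assumes "\<And>x. x \<in> A \<Longrightarrow> 0 \<le> e x"
  shows "fps_X ^ d * gser A w e = gser A w (\<lambda>x. int d + e x)"
proof (rule fps_ext)
  fix k
  show "fps_nth (fps_X ^ d * gser A w e) k = fps_nth (gser A w (\<lambda>x. int d + e x)) k"
  proof (cases "k < d")
    case True
    then have "{x \<in> A. int d + e x = int k} = {}"
      using assms by fastforce
    then show ?thesis
      using True by (simp only: gser_nth) (simp add: fps_X_power_mult_nth)
  next
    case False
    then have "{x \<in> A. int d + e x = int k} = {x \<in> A. e x = int (k - d)}"
      by auto
    then show ?thesis
      using False by (simp only: gser_nth fps_X_power_mult_nth) simp
  qed
qed

text \<open>Pairs of total exponent k are sorted by the exponent of their first component, which
  lies between 0 and k because both exponents are non-negative.\<close>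

lemma gser_mult:
  assumes "loc_fin A e" "loc_fin B e'"
  shows "gser A w e * gser B w' e' = gser (A \<times> B) (\<lambda>(x, y). w x * w' y) (\<lambda>(x, y). e x + e' y)"
proof (rule fps_ext)
  fix k
  let ?S = "\<lambda>i. {x \<in> A. e x = int i} \<times> {y \<in> B. e' y = int (k - i)}"
  have "fps_nth (gser A w e * gser B w' e') k = (\<Sum>i=0..k. \<Sum>p\<in>?S i. case p of (x, y) \<Rightarrow> w x * w' y)"
    by (simp add: fps_mult_nth gser_nth sum_product sum.cartesian_product)
  also have "\<dots> = (\<Sum>p\<in>(\<Union>i\<in>{0..k}. ?S i). case p of (x, y) \<Rightarrow> w x * w' y)"
    by (rule sum.UNION_disjoint[symmetric]) (auto intro: loc_fin_fibre assms)
  also have "(\<Union>i\<in>{0..k}. ?S i) = {p \<in> A \<times> B. (case p of (x, y) \<Rightarrow> e x + e' y) = int k}"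
  proof (intro set_eqI iffI)
    fix p assume "p \<in> {p \<in> A \<times> B. (case p of (x, y) \<Rightarrow> e x + e' y) = int k}"
    then obtain x y where p: "p = (x, y)" "x \<in> A" "y \<in> B" "e x + e' y = int k" by auto
    moreover have "0 \<le> e x" "0 \<le> e' y"
      using assms p by (auto simp: loc_fin_def)
    ultimately show "p \<in> (\<Union>i\<in>{0..k}. ?S i)"
      by (intro UN_I[of "nat (e x)"]) auto
  qed auto
  finally show "fps_nth (gser A w e * gser B w' e') k =
      fps_nth (gser (A \<times> B) (\<lambda>(x, y). w x * w' y) (\<lambda>(x, y). e x + e' y)) k"
    by (simp add: gser_nth)
qed

section \<open>Theta series\<close>

definition phi :: "nat \<Rightarrow> int fps" where
  "phi m = gser UNIV (\<lambda>_. 1) (\<lambda>n. int m * n\<^sup>2)"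

text \<open>This is phi(-q^m), since n^2 and n have the same parity.\<close>

definition phi_alt :: "nat \<Rightarrow> int fps" where
  "phi_alt m = gser UNIV (\<lambda>n. if even n then 1 else -1) (\<lambda>n. int m * n\<^sup>2)"

text \<open>Over the integers, \<open>2t^2 + t\<close> takes every triangular number as value exactly once.\<close>

definition psi :: "nat \<Rightarrow> int fps" where
  "psi m = gser UNIV (\<lambda>_. 1) (\<lambda>t. int m * (2 * t\<^sup>2 + t))"

lemma abs_le_square: "\<bar>n\<bar> \<le> (n::int)\<^sup>2"
proof (cases "n = 0")
  case False
  then have "\<bar>n\<bar> * 1 \<le> \<bar>n\<bar> * \<bar>n\<bar>"
    by (intro mult_left_mono) auto
  then show ?thesis
    by (simp add: power2_eq_square)
qed simp

lemma abs_le_of_nat_mult: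
  assumes "0 < m" "\<bar>n\<bar> \<le> a"
  shows "\<bar>n\<bar> \<le> int m * a"
proof -
  have "1 * a \<le> int m * a"
    using assms by (intro mult_right_mono) auto
  with assms(2) show ?thesis by linarith
qed

lemma loc_fin_square: "0 < m \<Longrightarrow> loc_fin A (\<lambda>n. int m * n\<^sup>2)"
  by (intro loc_finI_abs abs_le_of_nat_mult abs_le_square)

lemma abs_le_triangular: "\<bar>t\<bar> \<le> 2 * t\<^sup>2 + (t::int)"
  using abs_le_square[of t] by linarith

lemma loc_fin_triangular: "0 < m \<Longrightarrow> loc_fin A (\<lambda>t. int m * (2 * t\<^sup>2 + t))"
  by (intro loc_finI_abs abs_le_of_nat_mult abs_le_triangular)

section \<open>Lattice identities for theta functions\<close>

text \<open>Even n = 2k contribute phi(q^(4m)). Odd n are 4t + 1 or -(4t + 1), and (4t + 1)^2 = 1 +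
  8(2t^2 + t), so the classes 1 and 3 modulo 4 contribute the same series; the alternating sign only
  negates both.\<close>

lemma phi_dissect:
  assumes "0 < m"
  shows "phi m = phi (4 * m) + 2 * fps_X ^ m * psi (8 * m)"
    and "phi_alt m = phi (4 * m) - 2 * fps_X ^ m * psi (8 * m)"
proof -
  define e :: "int \<Rightarrow> int" where "e = (\<lambda>n. int m * n\<^sup>2)"
  have X: "fps_X ^ m * psi (8 * m) = gser UNIV (\<lambda>_. 1) (\<lambda>t. int m + int (8 * m) * (2 * t\<^sup>2 + t))"
    unfolding psi_def
  proof (rule gser_X_power)
    show "0 \<le> int (8 * m) * (2 * t\<^sup>2 + t)" for t
      using abs_le_triangular[of t] by (intro mult_nonneg_nonneg) linarith+
  qed
  have dis: "gser UNIV w e = gser {n. even n} w e + (gser {n. n mod 4 = 1} w e + gser {n. n mod 4 = 3} w e)" for w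
  proof -
    have *: "{n. even n} \<union> ({n. n mod 4 = 1} \<union> {n. n mod 4 = 3}) = (UNIV :: int set)"
      by auto presburger
    have "gser ({n. even n} \<union> ({n. n mod 4 = 1} \<union> {n. n mod 4 = 3})) w e =
        gser {n. even n} w e + gser ({n. n mod 4 = 1} \<union> {n. n mod 4 = 3}) w e"
      unfolding e_def using assms by (intro gser_Un loc_fin_square) (auto, presburger+)
    also have "gser ({n. n mod 4 = 1} \<union> {n. n mod 4 = 3}) w e = gser {n. n mod 4 = 1} w e + gser {n. n mod 4 = 3} w e"
      unfolding e_def using assms by (intro gser_Un loc_fin_square) auto
    finally show ?thesis unfolding * .
  qed
  have ev: "gser {n. even n} w e = phi (4 * m)" if "\<And>n. even n \<Longrightarrow> w n = 1" for w
    unfolding phi_def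
  proof (rule gser_reindex[of "\<lambda>k. 2 * k"])
    show "{n. even n} = range (\<lambda>k. 2 * k :: int)" by (auto simp: image_def elim!: evenE)
  qed (auto simp: inj_on_def e_def power2_eq_square that)
  have o1: "gser {n. n mod 4 = 1} w e = of_int c * (fps_X ^ m * psi (8 * m))" if "\<And>n. odd n \<Longrightarrow> w n = c" for w c
    unfolding X gser_const
  proof (rule gser_reindex[of "\<lambda>t. 4 * t + 1"])
    show "{n. n mod 4 = 1} = range (\<lambda>t. 4 * t + 1 :: int)" by (auto simp: image_def) presburger
  qed (auto simp: inj_on_def e_def power2_eq_square algebra_simps that)
  have o3: "gser {n. n mod 4 = 3} w e = of_int c * (fps_X ^ m * psi (8 * m))" if "\<And>n. odd n \<Longrightarrow> w n = c" for w c
    unfolding X gser_const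
  proof (rule gser_reindex[of "\<lambda>t. - (4 * t + 1)"])
    show "{n. n mod 4 = 3} = range (\<lambda>t. - (4 * t + 1) :: int)"
    proof (intro set_eqI iffI)
      fix n :: int assume "n \<in> {n. n mod 4 = 3}"
      then have "n = - (4 * (- (n div 4) - 1) + 1)" by simp presburger
      then show "n \<in> range (\<lambda>t. - (4 * t + 1) :: int)" by blast
    qed (auto, presburger)
  qed (auto simp: inj_on_def e_def power2_eq_square algebra_simps that)
  show "phi m = phi (4 * m) + 2 * fps_X ^ m * psi (8 * m)"
    using dis[of "\<lambda>_. 1"] ev[of "\<lambda>_. 1"] o1[of "\<lambda>_. 1" 1] o3[of "\<lambda>_. 1" 1]
    by (simp add: phi_def[of m] e_def)
  show "phi_alt m = phi (4 * m) - 2 * fps_X ^ m * psi (8 * m)"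
    using dis[of "\<lambda>n. if even n then 1 else - 1"] ev[of "\<lambda>n. if even n then 1 else - 1"]
      o1[of "\<lambda>n. if even n then 1 else - 1" "-1"] o3[of "\<lambda>n. if even n then 1 else - 1" "-1"]
    by (simp add: phi_alt_def[of m] e_def)
qed

text \<open>Up to a swap of coordinates this is multiplication by 1 + i on the Gaussian integers: it
  doubles the norm, and its image is the index 2 sublattice where a + b is even.\<close>

lemma gser_square_rotate:
  assumes "\<And>u v. w (u + v, u - v) = w' (u, v)"
  shows "gser {(a, b). even (a + b)} w (\<lambda>(a, b). int m * a\<^sup>2 + int m * b\<^sup>2) =
    gser UNIV w' (\<lambda>(u, v). int (2 * m) * u\<^sup>2 + int (2 * m) * v\<^sup>2)"
proof (rule gser_reindex[of "\<lambda>(u, v). (u + v, u - v)"])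
  show "{(a, b). even (a + b)} = range (\<lambda>(u, v). (u + v, u - v :: int))"
  proof (intro set_eqI iffI)
    fix p :: "int \<times> int" assume "p \<in> {(a, b). even (a + b)}"
    then obtain a b where p: "p = (a, b)" "even (a + b)" by auto
    from p(2) obtain u where "a + b = 2 * u" by (rule evenE)
    then have "p = (\<lambda>(u, v). (u + v, u - v)) (u, a - u)" using p by simp
    then show "p \<in> range (\<lambda>(u, v). (u + v, u - v))" by blast
  qed auto
  show "inj_on (\<lambda>(u, v). (u + v, u - v :: int)) UNIV"
    by (auto simp: inj_on_def)
  show "w (case x of (u, v) \<Rightarrow> (u + v, u - v)) = w' x" for x
    by (cases x) (simp add: assms)
  show "(case case x of (u, v) \<Rightarrow> (u + v, u - v) of (a, b) \<Rightarrow> int m * a\<^sup>2 + int m * b\<^sup>2) =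
      (case x of (u, v) \<Rightarrow> int (2 * m) * u\<^sup>2 + int (2 * m) * v\<^sup>2)" for x
    by (cases x) (simp add: power2_eq_square algebra_simps)
qed

text \<open>Both left-hand sides, the first after symmetrising in a and b, become lattice sums whose
  weights cancel when a + b is odd. On the remaining sublattice the substitution (u + v, u - v)
  turns the weights into products in u and v.\<close>

lemma
  assumes m: "0 < m"
  shows phi_mult_phi_alt: "phi m * phi_alt m = phi_alt (2 * m) ^ 2"
    and phi_sq_add_phi_alt_sq: "phi m ^ 2 + phi_alt m ^ 2 = 2 * phi (2 * m) ^ 2"
proof -
  define \<sigma> :: "int \<Rightarrow> int" where "\<sigma> n = (if even n then 1 else - 1)" for n
  let ?E = "\<lambda>(a, b). int m * a\<^sup>2 + int m * b\<^sup>2"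
  let ?F = "\<lambda>(a, b). int (2 * m) * a\<^sup>2 + int (2 * m) * b\<^sup>2"
  have L: "loc_fin UNIV ?E"
    using loc_fin_Times[OF loc_fin_square[OF m, of UNIV] loc_fin_square[OF m, of UNIV]] by simp
  have split: "gser UNIV w ?E = gser {(a, b). even (a + b)} w ?E + gser {(a, b). odd (a + b)} w ?E" for w
    using gser_split[OF L, of w "\<lambda>(a, b). even (a + b)"] by (simp add: case_prod_unfold)
  have pr: "gser UNIV w (\<lambda>n. int k * n\<^sup>2) * gser UNIV w' (\<lambda>n. int k * n\<^sup>2) =
      gser UNIV (\<lambda>(a, b). w a * w' b) (\<lambda>(a, b). int k * a\<^sup>2 + int k * b\<^sup>2)" if "k > 0" for w w' k
    by (simp add: gser_mult loc_fin_square that)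
  have alt: "phi_alt k = gser UNIV \<sigma> (\<lambda>n. int k * n\<^sup>2)" for k
    by (simp add: phi_alt_def \<sigma>_def[abs_def])
  have "2 * (phi m * phi_alt m) = phi m * phi_alt m + phi_alt m * phi m" by (simp add: mult.commute)
  also have "\<dots> = gser UNIV (\<lambda>(a, b). \<sigma> b + \<sigma> a) ?E"
    by (simp add: phi_def alt pr m gser_add case_prod_unfold)
  also have "\<dots> = gser {(a, b). even (a + b)} (\<lambda>(a, b). \<sigma> b + \<sigma> a) ?E"
    unfolding split by (subst (2) gser_eq_0) (auto simp: \<sigma>_def)
  also have "\<dots> = gser UNIV (\<lambda>(u, v). 2 * (\<sigma> u * \<sigma> v)) ?F"
    by (rule gser_square_rotate) (auto simp: \<sigma>_def)
  also have "\<dots> = 2 * (phi_alt (2 * m) * phi_alt (2 * m))"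
    using m gser_const[of 2 UNIV "\<lambda>(u, v). \<sigma> u * \<sigma> v" ?F, symmetric]
    unfolding alt by (subst pr) (auto simp: case_prod_unfold)
  finally show "phi m * phi_alt m = phi_alt (2 * m) ^ 2"
    by (simp add: power2_eq_square)
  have "phi m ^ 2 + phi_alt m ^ 2 = gser UNIV (\<lambda>(a, b). 1 + \<sigma> a * \<sigma> b) ?E"
    by (simp only: phi_def alt power2_eq_square[of "gser _ _ _"] pr[OF m] gser_add) (simp add: case_prod_unfold)
  also have "\<dots> = gser {(a, b). even (a + b)} (\<lambda>(a, b). 1 + \<sigma> a * \<sigma> b) ?E"
    unfolding split by (subst (2) gser_eq_0) (auto simp: \<sigma>_def)
  also have "\<dots> = gser UNIV (\<lambda>(u, v). 2) ?F"
    by (rule gser_square_rotate) (auto simp: \<sigma>_def)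
  also have "\<dots> = 2 * (phi (2 * m) * phi (2 * m))"
    using m gser_const[of 2 UNIV "\<lambda>(u, v). 1" ?F, symmetric]
    unfolding phi_def by (subst pr) (auto simp: case_prod_unfold)
  finally show "phi m ^ 2 + phi_alt m ^ 2 = 2 * phi (2 * m) ^ 2"
    by (simp add: power2_eq_square)
qed

lemma psi_mult_psi:
  "0 < a \<Longrightarrow> 0 < b \<Longrightarrow> psi a * psi b =
    gser UNIV (\<lambda>_. 1) (\<lambda>(s, t). int a * (2 * s\<^sup>2 + s) + int b * (2 * t\<^sup>2 + t))"
  unfolding psi_def using loc_fin_triangular by (subst gser_mult) (auto simp: case_prod_unfold)

lemma phi_mult_psi:
  "0 < a \<Longrightarrow> 0 < b \<Longrightarrow> phi a * psi b =
    gser UNIV (\<lambda>_. 1) (\<lambda>(k, j). int a * k\<^sup>2 + int b * (2 * j\<^sup>2 + j))"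
  unfolding phi_def psi_def using loc_fin_square loc_fin_triangular
  by (subst gser_mult) (auto simp: case_prod_unfold)

text \<open>Completing the square in 2s^2 + s + 3(2t^2 + t) diagonalises the form differently
  according to the parity of s - t; the two cases give the two summands.\<close>

lemma psi_mult_psi_3:
  assumes m: "0 < m"
  shows "psi m * psi (3 * m) = phi (6 * m) * psi (4 * m) + fps_X ^ m * phi (2 * m) * psi (12 * m)"
proof -
  define e :: "int \<times> int \<Rightarrow> int"
    where "e = (\<lambda>(s, t). int m * (2 * s\<^sup>2 + s) + int (3 * m) * (2 * t\<^sup>2 + t))"
  have L: "loc_fin UNIV e"
    using loc_fin_Times[OF loc_fin_triangular[OF m, of UNIV] loc_fin_triangular[of "3 * m" UNIV]] m
    by (simp add: e_def)
  have "psi m * psi (3 * m) = gser UNIV (\<lambda>_. 1) e"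
    using m by (simp only: psi_mult_psi e_def)
  also have "\<dots> = gser {p. even (fst p - snd p)} (\<lambda>_. 1) e + gser {p. \<not> even (fst p - snd p)} (\<lambda>_. 1) e"
    using gser_split[OF L, of "\<lambda>_. 1" "\<lambda>p. even (fst p - snd p)"] by simp
  also have "gser {p. even (fst p - snd p)} (\<lambda>_. 1) e =
      gser UNIV (\<lambda>_. 1) (\<lambda>(k, j). int (6 * m) * k\<^sup>2 + int (4 * m) * (2 * j\<^sup>2 + j))" (is "_ = gser UNIV _ ?e1")
  proof (rule gser_reindex_inverse)
    \<comment> \<open>With s = t + 2k and z = t + k/2 the form equals 6k^2 + 4(2z^2 + z). For even k
      take j = z. For odd k, z is a half-integer, and the reflection z -> -z - 1/2, which fixes 2z^2
      + z, supplies the integer j.\<close>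
    define h :: "int \<times> int \<Rightarrow> int \<times> int" where
      "h = (\<lambda>(k, j). let t = if even k then j - k div 2 else - j - (k + 1) div 2 in (t + 2 * k, t))"
    define g :: "int \<times> int \<Rightarrow> int \<times> int" where
      "g = (\<lambda>(s, t). let k = (s - t) div 2 in (k, if even k then t + k div 2 else - t - (k + 1) div 2))"
    fix x
    show "h x \<in> {p. even (fst p - snd p)} \<and> g (h x) = x \<and> e (h x) = ?e1 x \<and> (1::int) = 1"
    proof -
      obtain k j where x: "x = (k, j)" by (cases x)
      have "\<exists>i. k = 2 * i \<or> k = 2 * i + 1" by presburger
      then obtain i where "k = 2 * i \<or> k = 2 * i + 1" ..
      then show ?thesis
        by (auto simp: x h_def g_def e_def Let_def power2_eq_square algebra_simps)
    qed
    fix y :: "int \<times> int"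
    assume y: "y \<in> {p. even (fst p - snd p)}"
    obtain s t where y': "y = (s, t)" by (cases y)
    have "\<exists>k. s = t + 2 * k"
      using y unfolding y' by simp presburger
    then obtain k where k: "s = t + 2 * k" ..
    have "\<exists>i. k = 2 * i \<or> k = 2 * i + 1" by presburger
    then obtain i where "k = 2 * i \<or> k = 2 * i + 1" ..
    then show "g y \<in> UNIV \<and> h (g y) = y"
      by (auto simp: y' k h_def g_def Let_def algebra_simps)
  qed
  also have "\<dots> = phi (6 * m) * psi (4 * m)"
    using m by (intro phi_mult_psi[symmetric]) auto
  also have "gser {p. \<not> even (fst p - snd p)} (\<lambda>_. 1) e =
      gser UNIV (\<lambda>_. 1) (\<lambda>x. int m + (case x of (k, j) \<Rightarrow> int (2 * m) * k\<^sup>2 + int (12 * m) * (2 * j\<^sup>2 + j)))"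
      (is "_ = gser UNIV _ ?e2")
  proof (rule gser_reindex_inverse)
    \<comment> \<open>An odd s - t is 4j + 1 or -(4j + 1) for a unique j. In both cases the form
      equals 1 + 2k^2 + 12(2j^2 + j), with k = 2(t + j) + 1 in the first and k = 2(t - j) in the
      second, so the parity of k records the sign.\<close>
    define h :: "int \<times> int \<Rightarrow> int \<times> int" where
      "h = (\<lambda>(k, j). if even k then (k div 2 - 3 * j - 1, k div 2 + j) else (k div 2 + 3 * j + 1, k div 2 - j))"
    define g :: "int \<times> int \<Rightarrow> int \<times> int" where
      "g = (\<lambda>(s, t). if (s - t) mod 4 = 1 then (let j = (s - t) div 4 in (2 * (t + j) + 1, j))
        else (let j = (t - s) div 4 in (2 * (t - j), j)))"
    fix x
    show "h x \<in> {p. \<not> even (fst p - snd p)} \<and> g (h x) = x \<and> e (h x) = ?e2 x \<and> (1::int) = 1"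
    proof -
      obtain k j where x: "x = (k, j)" by (cases x)
      have "\<exists>i. k = 2 * i \<or> k = 2 * i + 1" by presburger
      then obtain i where "k = 2 * i \<or> k = 2 * i + 1" ..
      moreover have "(- 1 - 4 * j) mod 4 = 3" "(1 + 4 * j) mod 4 = 1" "(1 + 4 * j) div 4 = j" by presburger+
      ultimately show ?thesis
        by (auto simp: x h_def g_def e_def Let_def power2_eq_square algebra_simps)
    qed
    fix y :: "int \<times> int"
    assume y: "y \<in> {p. \<not> even (fst p - snd p)}"
    obtain s t where y': "y = (s, t)" by (cases y)
    have "(\<exists>j. s = t + (4 * j + 1)) \<or> (\<exists>j. s = t - (4 * j + 1))"
      using y unfolding y' by simp presburger
    moreover have "(- 1 - 4 * j) mod 4 = 3" "(1 + 4 * j) mod 4 = 1" "(1 + 4 * j) div 4 = j" for j :: int by presburger+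
    ultimately show "g y \<in> UNIV \<and> h (g y) = y"
      by (auto simp: y' h_def g_def Let_def algebra_simps)
  qed
  also have "\<dots> = fps_X ^ m * gser UNIV (\<lambda>_. 1) (\<lambda>(k, j). int (2 * m) * k\<^sup>2 + int (12 * m) * (2 * j\<^sup>2 + j))"
    using loc_fin_Times[OF loc_fin_square[of "2 * m" UNIV] loc_fin_triangular[of "12 * m" UNIV]] m
    by (subst gser_X_power) (auto simp: loc_fin_def)
  also have "\<dots> = fps_X ^ m * phi (2 * m) * psi (12 * m)"
    using m by (simp only: mult.assoc phi_mult_psi[of "2 * m" "12 * m"])
  finally show ?thesis .
qed

section \<open>Gauss's product formulas\<close>

lemma fps_X_power_dvd_iff:
  "fps_X ^ N dvd (h :: int fps) \<longleftrightarrow> (\<forall>k<N. fps_nth h k = 0)"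
proof
  assume h: "\<forall>k<N. fps_nth h k = 0"
  have "h = fps_X ^ N * fps_shift N h"
    by (rule fps_ext) (use h in \<open>auto simp: fps_X_power_mult_nth\<close>)
  then show "fps_X ^ N dvd h" by (rule dvdI)
qed (auto simp: fps_X_power_mult_nth elim!: dvdE)

text \<open>This reduces identities between infinite products and theta series to finite truncations
  modulo each power of q.\<close>

lemma fps_eqI_dvd:
  assumes "\<And>N. fps_X ^ N dvd (f - g :: int fps)"
  shows "f = g"
proof (rule fps_ext)
  fix k
  show "fps_nth f k = fps_nth g k"
    using assms[of "Suc k"] unfolding fps_X_power_dvd_iff by simp
qed

lemma dvd_diff_mult:
  fixes a b c d p :: "'a :: comm_ring_1"
  assumes "p dvd a - b" "p dvd c - d"
  shows "p dvd a * c - b * d"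
proof -
  have "a * c - b * d = (a - b) * c + b * (c - d)" by (simp add: algebra_simps)
  then show ?thesis using assms by simp
qed

lemma dvd_diff_power:
  fixes a b p :: "'a :: comm_ring_1"
  shows "p dvd a - b \<Longrightarrow> p dvd a ^ n - b ^ n"
  by (induction n) (auto intro: dvd_diff_mult)

lemma dvd_diff_trans:
  fixes a b c p :: "'a :: comm_ring_1"
  shows "p dvd a - b \<Longrightarrow> p dvd b - c \<Longrightarrow> p dvd a - c"
  using dvd_add[of p "a - b" "b - c"] by simp

lemma dvd_diff_sym:
  fixes a b p :: "'a :: comm_ring_1"
  shows "p dvd a - b \<Longrightarrow> p dvd b - a"
  by (metis dvd_minus_iff minus_diff_eq)

text \<open>The factors beyond the first N are 1 modulo X^N, so the partial products are stable
  modulo X^N from N on, and the coefficientwise limit inherits their low coefficients.\<close>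

lemma euler_f_approx:
  assumes "0 < m"
  shows "fps_X ^ N dvd euler_f m - (\<Prod>r<N. 1 - (fps_X ^ m) ^ Suc r)"
proof -
  define P :: "nat \<Rightarrow> int fps" where "P n = (\<Prod>r<n. 1 - (fps_X ^ m) ^ Suc r)" for n
  have "(\<lambda>n. \<Prod>i\<le>n. 1 - fps_X ^ (m * Suc i) :: int fps) \<longlonglongrightarrow> euler_f m"
    using euler_f_has_prod(1)[of m] assms by (intro has_prod_imp_tendsto) auto
  also have "(\<lambda>n. \<Prod>i\<le>n. 1 - fps_X ^ (m * Suc i) :: int fps) = (\<lambda>n. P (Suc n))"
    unfolding P_def lessThan_Suc_atMost power_mult ..
  finally have lim: "(\<lambda>n. P (Suc n)) \<longlonglongrightarrow> euler_f m" .
  have step: "fps_X ^ n dvd P (Suc n) - P n" for n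
  proof -
    have "P (Suc n) - P n = - (P n * (fps_X ^ m) ^ Suc n)"
      by (simp add: P_def algebra_simps)
    moreover have "1 * Suc n \<le> m * Suc n"
      using assms by (intro mult_le_mono1) auto
    then have "n \<le> m * Suc n" by (rule order_trans[rotated]) simp
    then have "fps_X ^ n dvd (fps_X ^ m :: int fps) ^ Suc n"
      unfolding power_mult[symmetric] by (rule le_imp_power_dvd)
    ultimately show ?thesis by simp
  qed
  have stable: "fps_X ^ N dvd P n - P N" if "N \<le> n" for n
    using that
  proof (induction n rule: dec_induct)
    case (step n)
    have "fps_X ^ N dvd (fps_X ^ n :: int fps)"
      using step.hyps by (intro le_imp_power_dvd) auto
    with \<open>\<And>n. fps_X ^ n dvd P (Suc n) - P n\<close> have "fps_X ^ N dvd P (Suc n) - P n"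
      by (meson dvd_trans)
    with step.IH show ?case by (rule dvd_diff_trans[rotated])
  qed simp
  have "fps_nth (euler_f m) k = fps_nth (P N) k" if "k < N" for k
  proof -
    have "eventually (\<lambda>n. fps_nth (P (Suc n)) k = fps_nth (euler_f m) k) sequentially"
      using lim by (simp add: tendsto_fps_iff)
    then obtain n0 where n0: "\<And>n. n \<ge> n0 \<Longrightarrow> fps_nth (P (Suc n)) k = fps_nth (euler_f m) k"
      by (auto simp: eventually_sequentially)
    show ?thesis
      using n0[of "max n0 N"] stable[of "Suc (max n0 N)"] that
      unfolding fps_X_power_dvd_iff by simp
  qed
  then show ?thesis
    unfolding fps_X_power_dvd_iff P_def by simp
qed

lemma gser_approx:
  assumes "finite A" "\<And>x. 0 \<le> e x" "\<And>x. x \<notin> A \<Longrightarrow> int N \<le> e x"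
  shows "fps_X ^ N dvd gser UNIV w e - (\<Sum>x\<in>A. of_int (w x) * fps_X ^ nat (e x))"
  unfolding fps_X_power_dvd_iff
proof (intro allI impI)
  fix k assume "k < N"
  have "{x. e x = int k} = {x \<in> A. e x = int k}"
    using assms(3) \<open>k < N\<close> by force
  then have "fps_nth (gser UNIV w e) k = (\<Sum>x\<in>A. if e x = int k then w x else 0)"
    by (simp add: gser_nth sum.inter_filter[OF assms(1)])
  also have "\<dots> = fps_nth (\<Sum>x\<in>A. of_int (w x) * fps_X ^ nat (e x)) k"
    unfolding fps_sum_nth
  proof (rule sum.cong)
    fix x
    have "of_int (w x) = fps_const (w x)"
      using fps_of_int[of "w x", where ?'a = int] by simp
    then show "(if e x = int k then w x else 0) = fps_nth (of_int (w x) * fps_X ^ nat (e x)) k"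
      using assms(2)[of x] by auto
  qed simp
  finally show "fps_nth (gser UNIV w e - (\<Sum>x\<in>A. of_int (w x) * fps_X ^ nat (e x))) k = 0"
    by simp
qed

lemma sum_symmetric_interval_Suc:
  fixes f :: "int \<Rightarrow> 'a :: comm_monoid_add"
  shows "sum f {- int (Suc n)..int (Suc n)} =
    sum f {- int n..int n} + f (int n + 1) + f (- int n - 1)"
proof -
  have "{- int (Suc n)..int (Suc n)} = insert (- int n - 1) (insert (int n + 1) {- int n..int n})"
    by auto
  then show ?thesis by (simp add: ac_simps)
qed

text \<open>
  Finite forms due to Shanks. The induction steps telescope, and modulo \<open>x^n\<close> only the summand for
  \<open>s = 0\<close> survives on the right.
\<close>

lemma Gauss_triangular_finite:
  fixes x :: "'a :: comm_ring_1"
  shows "(\<Prod>r<n. 1 - x ^ (2 * r + 1)) * (\<Sum>t=-int n..int n. x ^ nat (2 * t\<^sup>2 + t)) =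
    (\<Sum>s\<le>n. (\<Prod>r<s. 1 - x ^ (2 * r + 1)) * (\<Prod>r=s..<n. 1 - x ^ (2 * r + 2)) * x ^ (s * (2 * n + 1)))"
proof (induction n)
  case (Suc n)
  define Q where "Q s = (\<Prod>r<s. 1 - x ^ (2 * r + 1))" for s
  define R where "R s = (\<Prod>r=s..<n. 1 - x ^ (2 * r + 2))" for s
  define y where "y = x ^ (2 * n + 1)"
  have y: "x ^ (s * (2 * n + 1)) = y ^ s" for s
    by (simp only: y_def power_mult[symmetric] mult.commute)
  \<comment> \<open>\<open>T s\<close> is the s-th summand for n + 1 minus (1 - y) times the s-th
    summand for n. Its sum telescopes to the contribution of the new index t = -(n + 1); the index t
    = n + 1 supplies the new summand s = n + 1.\<close>
  define T where "T s = Q s * R s * y ^ s * ((1 - x * y) * x ^ (2 * s) - (1 - y))" for s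
  have tele: "(\<Sum>s\<le>k. T s) = Q (Suc k) * R k * y ^ Suc k" if "k \<le> n" for k
    using that
  proof (induction k)
    case 0
    show ?case by (simp add: T_def Q_def algebra_simps)
  next
    case (Suc k)
    have "R k = (1 - x ^ (2 * k + 2)) * R (Suc k)"
      using Suc.prems unfolding R_def by (subst prod.atLeast_Suc_lessThan) auto
    moreover have "Q (Suc (Suc k)) = Q (Suc k) * (1 - x ^ (2 * k + 2) * x)"
      by (simp add: Q_def mult.commute)
    moreover have "x ^ (2 * Suc k) = x ^ (2 * k + 2)" by simp
    ultimately show ?case
      using Suc unfolding T_def sum.atMost_Suc by (simp only: power_Suc) (simp add: algebra_simps)
  qed
  have "nat (2 * (int n + 1)\<^sup>2 + (int n + 1)) = Suc n * (2 * n + 1) + 2 * Suc n"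
    "nat (2 * (- int n - 1)\<^sup>2 + (- int n - 1)) = Suc n * (2 * n + 1)"
    by (simp_all add: nat_eq_iff power2_eq_square algebra_simps)
  then have sq: "x ^ nat (2 * (int n + 1)\<^sup>2 + (int n + 1)) = y ^ Suc n * x ^ (2 * Suc n)"
    "x ^ nat (2 * (- int n - 1)\<^sup>2 + (- int n - 1)) = y ^ Suc n"
    by (simp_all only: power_add y)
  have QS: "Q (Suc n) = (1 - y) * Q n"
    by (simp add: Q_def y_def)
  have "Q (Suc n) * (\<Sum>t=-int (Suc n)..int (Suc n). x ^ nat (2 * t\<^sup>2 + t)) =
      (1 - y) * (Q n * (\<Sum>t=-int n..int n. x ^ nat (2 * t\<^sup>2 + t))) +
      Q (Suc n) * y ^ Suc n + Q (Suc n) * (y ^ Suc n * x ^ (2 * Suc n))"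
    unfolding sum_symmetric_interval_Suc sq by (simp only: distrib_left QS mult.assoc add_ac)
  also have "Q n * (\<Sum>t=-int n..int n. x ^ nat (2 * t\<^sup>2 + t)) = (\<Sum>s\<le>n. Q s * R s * y ^ s)"
    using Suc.IH unfolding Q_def[symmetric] R_def[symmetric] y .
  also have "(1 - y) * \<dots> + Q (Suc n) * y ^ Suc n = (1 - y) * (\<Sum>s\<le>n. Q s * R s * y ^ s) + (\<Sum>s\<le>n. T s)"
    using tele[of n] by (simp add: R_def)
  also have "\<dots> = (\<Sum>s\<le>n. Q s * (R s * (1 - x * y)) * (y ^ s * x ^ (2 * s)))"
    by (simp add: sum_distrib_left sum.distrib[symmetric] T_def algebra_simps)
  also have "\<dots> = (\<Sum>s\<le>n. Q s * (\<Prod>r=s..<Suc n. 1 - x ^ (2 * r + 2)) * x ^ (s * (2 * Suc n + 1)))"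
  proof (rule sum.cong)
    fix s assume "s \<in> {..n}"
    then have "(\<Prod>r=s..<Suc n. 1 - x ^ (2 * r + 2)) = R s * (1 - x * y)"
      by (simp add: R_def y_def)
    moreover have "x ^ (s * (2 * Suc n + 1)) = y ^ s * x ^ (2 * s)"
      unfolding y[symmetric] power_add[symmetric] by (simp add: algebra_simps)
    ultimately show "Q s * (R s * (1 - x * y)) * (y ^ s * x ^ (2 * s)) =
        Q s * (\<Prod>r=s..<Suc n. 1 - x ^ (2 * r + 2)) * x ^ (s * (2 * Suc n + 1))"
      by simp
  qed simp
  also have "y ^ Suc n * x ^ (2 * Suc n) = x ^ (Suc n * (2 * Suc n + 1))"
    unfolding y[symmetric] power_add[symmetric] by (simp add: algebra_simps)
  finally show ?case
    unfolding sum.atMost_Suc Q_def[symmetric] by (simp only: atLeastLessThan_empty[OF order_refl] prod.empty mult_1_right)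
qed simp

lemma Gauss_square_finite:
  fixes x :: "'a :: comm_ring_1"
  shows "(\<Prod>r<n. 1 + x ^ Suc r) * (\<Sum>t=-int n..int n. (if even t then 1 else - 1) * x ^ nat (t\<^sup>2)) =
    (\<Sum>s\<le>n. (- 1) ^ s * (\<Prod>r<s. 1 + x ^ r) * (\<Prod>r=s..<n. 1 - x ^ Suc r) * x ^ (s * Suc n))"
proof (induction n)
  case (Suc n)
  define Q where "Q s = (- 1) ^ s * (\<Prod>r<s. 1 + x ^ r)" for s
  define R where "R s = (\<Prod>r=s..<n. 1 - x ^ Suc r)" for s
  define D where "D n = (\<Prod>r<n. 1 + x ^ Suc r)" for n
  define y where "y = x ^ Suc n"
  have y: "x ^ (s * Suc n) = y ^ s" for s
    by (simp only: y_def power_mult[symmetric] mult.commute)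
  \<comment> \<open>Again \<open>T s\<close> is the new s-th summand minus the old one multiplied by
    the new factor 1 + y of the product.\<close>
  define T where "T s = Q s * R s * y ^ s * ((1 - y) * x ^ s - (1 + y))" for s
  have tele: "(\<Sum>s\<le>k. T s) = Q (Suc k) * R k * y ^ Suc k" if "k \<le> n" for k
    using that
  proof (induction k)
    case 0
    show ?case by (simp add: T_def Q_def algebra_simps)
  next
    case (Suc k)
    have R: "R k = (1 - x ^ Suc k) * R (Suc k)"
      using Suc.prems unfolding R_def by (subst prod.atLeast_Suc_lessThan) auto
    have Q: "Q (Suc (Suc k)) = - Q (Suc k) * (1 + x ^ Suc k)"
      by (simp add: Q_def)
    have IH: "(\<Sum>s\<le>k. T s) = Q (Suc k) * R k * y ^ Suc k"
      using Suc by simp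
    show ?case
      unfolding sum.atMost_Suc IH unfolding R Q T_def by (simp add: algebra_simps)
  qed
  have sq: "nat ((int n + 1)\<^sup>2) = Suc n * Suc n"
    "nat ((- int n - 1)\<^sup>2) = Suc n * Suc n"
    by (simp_all add: nat_eq_iff power2_eq_square algebra_simps)
  have sg: "(if even (int n + 1) then 1 else - 1) = ((- 1) ^ Suc n :: 'a)"
    "(if even (- int n - 1) then 1 else - 1) = ((- 1) ^ Suc n :: 'a)"
    by auto
  \<comment> \<open>The factor r = 0 of \<open>Q (Suc n)\<close> is 1 + x^0 = 2; it matches the two
    equal contributions of t = n + 1 and t = -(n + 1).\<close>
  have QD: "Q (Suc n) = 2 * (- 1) ^ Suc n * D n"
    by (simp only: Q_def D_def prod.lessThan_Suc_shift) (simp add: algebra_simps)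
  have "D (Suc n) * (\<Sum>t=-int (Suc n)..int (Suc n). (if even t then 1 else - 1) * x ^ nat (t\<^sup>2)) =
      (1 + y) * (D n * (\<Sum>t=-int n..int n. (if even t then 1 else - 1) * x ^ nat (t\<^sup>2))) +
      2 * (- 1) ^ Suc n * D (Suc n) * y ^ Suc n"
    unfolding sum_symmetric_interval_Suc sq sg y
    by (simp add: D_def y_def algebra_simps)
  also have "D n * (\<Sum>t=-int n..int n. (if even t then 1 else - 1) * x ^ nat (t\<^sup>2)) = (\<Sum>s\<le>n. Q s * R s * y ^ s)"
    using Suc.IH unfolding Q_def[symmetric] R_def[symmetric] D_def[symmetric] y .
  also have "2 * (- 1) ^ Suc n * D (Suc n) * y ^ Suc n = (\<Sum>s\<le>n. T s) + Q (Suc n) * y ^ Suc n * y"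
    using tele[of n] unfolding QD by (simp add: R_def D_def y_def algebra_simps)
  also have "(1 + y) * (\<Sum>s\<le>n. Q s * R s * y ^ s) + ((\<Sum>s\<le>n. T s) + Q (Suc n) * y ^ Suc n * y) =
      (\<Sum>s\<le>n. Q s * (R s * (1 - y)) * (y ^ s * x ^ s)) + Q (Suc n) * (y ^ Suc n * y)"
    by (simp add: sum_distrib_left sum.distrib[symmetric] T_def algebra_simps)
  also have "(\<Sum>s\<le>n. Q s * (R s * (1 - y)) * (y ^ s * x ^ s)) =
      (\<Sum>s\<le>n. Q s * (\<Prod>r=s..<Suc n. 1 - x ^ Suc r) * x ^ (s * Suc (Suc n)))"
  proof (rule sum.cong)
    fix s assume "s \<in> {..n}"
    then have "(\<Prod>r=s..<Suc n. 1 - x ^ Suc r) = R s * (1 - y)"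
      by (simp add: R_def y_def)
    moreover have "x ^ (s * Suc (Suc n)) = y ^ s * x ^ s"
      unfolding y[symmetric] power_add[symmetric] by (simp add: algebra_simps)
    ultimately show "Q s * (R s * (1 - y)) * (y ^ s * x ^ s) =
        Q s * (\<Prod>r=s..<Suc n. 1 - x ^ Suc r) * x ^ (s * Suc (Suc n))"
      by simp
  qed simp
  also have "y ^ Suc n * y = x ^ (Suc n * Suc (Suc n))"
    using y[of "Suc (Suc n)"] by (simp only: power_Suc2 mult.commute)
  finally show ?case by (simp add: Q_def D_def)
qed simp

lemma dvd_finite_head:
  fixes x :: "int fps"
  assumes "\<And>s. 1 \<le> s \<Longrightarrow> fps_X ^ N dvd x ^ (s * k)"
  shows "fps_X ^ N dvd (\<Sum>s\<le>n. c s * x ^ (s * k)) - c 0"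
proof -
  have "(\<Sum>s\<le>n. c s * x ^ (s * k)) - c 0 = (\<Sum>s\<in>{1..n}. c s * x ^ (s * k))"
    by (simp add: sum.atMost_shift[of _ n] atLeast1_atMost_eq_remove0 atMost_atLeast0 sum.remove[of "{0..n}" 0])
  also have "fps_X ^ N dvd \<dots>"
    using assms by (intro dvd_sum dvd_mult) auto
  finally show ?thesis .
qed

lemma fps_X_power_dvd_power:
  assumes "0 < m" "N \<le> k" "1 \<le> s"
  shows "fps_X ^ N dvd ((fps_X ^ m) ^ (s * k) :: int fps)"
proof -
  have "1 * k \<le> (m * s) * k"
    using assms by (intro mult_le_mono1) (simp add: Suc_le_eq)
  then have "N \<le> m * (s * k)"
    using assms(2) by (simp only: mult.assoc)
  then show ?thesis
    unfolding power_mult[symmetric] by (rule le_imp_power_dvd)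
qed

lemma psi_approx:
  assumes "0 < m"
  shows "fps_X ^ N dvd psi m - (\<Sum>t=-int N..int N. (fps_X ^ m) ^ nat (2 * t\<^sup>2 + t))"
proof -
  have e: "0 \<le> 2 * t\<^sup>2 + t" for t :: int
    using abs_le_triangular[of t] by linarith
  have "fps_X ^ N dvd psi m -
      (\<Sum>t=-int N..int N. of_int 1 * fps_X ^ nat (int m * (2 * t\<^sup>2 + t)))"
    unfolding psi_def
  proof (rule gser_approx)
    show "0 \<le> int m * (2 * t\<^sup>2 + t)" for t
      using e by simp
    show "int N \<le> int m * (2 * t\<^sup>2 + t)" if "t \<notin> {- int N..int N}" for t
      using abs_le_of_nat_mult[OF assms abs_le_triangular[of t]] that by auto
  qed simp
  then show ?thesis
    by (simp add: power_mult[symmetric] nat_mult_distrib)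
qed

lemma phi_alt_approx:
  assumes "0 < m"
  shows "fps_X ^ N dvd phi_alt m -
    (\<Sum>t=-int N..int N. (if even t then 1 else - 1) * (fps_X ^ m) ^ nat (t\<^sup>2))"
proof -
  have "fps_X ^ N dvd phi_alt m -
      (\<Sum>t=-int N..int N. of_int (if even t then 1 else - 1) * fps_X ^ nat (int m * t\<^sup>2))"
    unfolding phi_alt_def
  proof (rule gser_approx)
    show "int N \<le> int m * t\<^sup>2" if "t \<notin> {- int N..int N}" for t
      using abs_le_of_nat_mult[OF assms abs_le_square[of t]] that by auto
  qed simp_all
  moreover have "of_int (if even t then 1 else - 1) = (if even t then 1 else - 1 :: int fps)" for t :: int
    by simp
  ultimately show ?thesis
    by (simp add: power_mult[symmetric] nat_mult_distrib)
qed

text \<open>With Q the odd and R the even factors, the finite form gives Q S = R modulo X^N.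
  Multiplying by R gives S (Q R) = R^2, where Q R truncates f_m and R truncates f_(2m).\<close>

lemma psi_mult_euler_f:
  assumes m: "0 < m"
  shows "psi m * euler_f m = euler_f (2 * m) ^ 2"
proof (rule fps_eqI_dvd)
  fix N
  define x :: "int fps" where "x = fps_X ^ m"
  define S where "S = (\<Sum>t=-int N..int N. x ^ nat (2 * t\<^sup>2 + t))"
  define Q where "Q n = (\<Prod>r<n. 1 - x ^ (2 * r + 1))" for n
  define R where "R n = (\<Prod>r<n. 1 - x ^ (2 * r + 2))" for n
  have QR: "Q n * R n = (\<Prod>r<2 * n. 1 - x ^ Suc r)" for n
    by (induction n) (simp_all add: Q_def R_def mult_ac)
  have "fps_X ^ N dvd Q N * S - R N"
    unfolding Q_def S_def Gauss_triangular_finite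
    using dvd_finite_head[of N x "2 * N + 1" "\<lambda>s. (\<Prod>r<s. 1 - x ^ (2 * r + 1)) * (\<Prod>r=s..<N. 1 - x ^ (2 * r + 2))" N]
      fps_X_power_dvd_power[OF m, of N "2 * N + 1"]
    by (simp add: R_def atLeast0LessThan x_def)
  then have 1: "fps_X ^ N dvd S * (Q N * R N) - R N ^ 2"
    by (metis (no_types, lifting) dvd_mult2 left_diff_distrib mult.commute mult.left_commute power2_eq_square)
  \<comment> \<open>Q R consists of the first 2N factors of f_m, hence the approximation to the
    higher order 2N, which is then weakened.\<close>
  have "fps_X ^ (2 * N) dvd euler_f m - Q N * R N"
    using euler_f_approx[OF m, of "2 * N"] by (simp only: QR x_def)
  then have "fps_X ^ N dvd euler_f m - Q N * R N"
    by (rule dvd_trans[rotated]) (simp add: le_imp_power_dvd)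
  with psi_approx[OF m, of N] have 2: "fps_X ^ N dvd psi m * euler_f m - S * (Q N * R N)"
    unfolding S_def x_def by (rule dvd_diff_mult)
  have "R N = (\<Prod>r<N. 1 - (fps_X ^ (2 * m)) ^ Suc r)"
    unfolding R_def x_def power_mult[symmetric] by (simp add: algebra_simps)
  then have "fps_X ^ N dvd euler_f (2 * m) - R N"
    using euler_f_approx[of "2 * m" N] m by simp
  then have "fps_X ^ N dvd euler_f (2 * m) ^ 2 - R N ^ 2"
    by (rule dvd_diff_power)
  with 1 2 show "fps_X ^ N dvd psi m * euler_f m - euler_f (2 * m) ^ 2"
    by (meson dvd_diff_sym dvd_diff_trans)
qed

text \<open>The finite form gives Q S = R modulo X^N. After multiplication by R, the factors (1 +
  y)(1 - y) = 1 - y^2 of Q R are those of f_(2m).\<close>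

lemma phi_alt_mult_euler_f:
  assumes m: "0 < m"
  shows "phi_alt m * euler_f (2 * m) = euler_f m ^ 2"
proof (rule fps_eqI_dvd)
  fix N
  define x :: "int fps" where "x = fps_X ^ m"
  define S where "S = (\<Sum>t=-int N..int N. (if even t then 1 else - 1) * x ^ nat (t\<^sup>2))"
  define Q where "Q = (\<Prod>r<N. 1 + x ^ Suc r)"
  define R where "R = (\<Prod>r<N. 1 - x ^ Suc r)"
  have "fps_X ^ N dvd Q * S - R"
    unfolding Q_def S_def Gauss_square_finite
    using dvd_finite_head[of N x "Suc N" "\<lambda>s. (- 1) ^ s * (\<Prod>r<s. 1 + x ^ r) * (\<Prod>r=s..<N. 1 - x ^ Suc r)" N]
      fps_X_power_dvd_power[OF m, of N "Suc N"]
    by (simp add: R_def atLeast0LessThan x_def)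
  then have 1: "fps_X ^ N dvd S * (Q * R) - R ^ 2"
    by (metis (no_types, lifting) dvd_mult2 left_diff_distrib mult.commute mult.left_commute power2_eq_square)
  have "Q * R = (\<Prod>r<N. 1 - (fps_X ^ (2 * m)) ^ Suc r)"
    unfolding Q_def R_def prod.distrib[symmetric]
  proof (rule prod.cong)
    fix r
    have "(fps_X ^ (2 * m)) ^ Suc r = (x ^ Suc r) * (x ^ Suc r)"
      unfolding x_def power_mult[symmetric] power_add[symmetric] by (simp add: algebra_simps)
    then show "(1 + x ^ Suc r) * (1 - x ^ Suc r) = 1 - (fps_X ^ (2 * m)) ^ Suc r"
      by (simp only:) (simp add: algebra_simps)
  qed simp
  then have "fps_X ^ N dvd euler_f (2 * m) - Q * R"
    using euler_f_approx[of "2 * m" N] m by simp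
  with phi_alt_approx[OF m, of N] have 2: "fps_X ^ N dvd phi_alt m * euler_f (2 * m) - S * (Q * R)"
    unfolding S_def x_def by (rule dvd_diff_mult)
  have "fps_X ^ N dvd euler_f m ^ 2 - R ^ 2"
    using euler_f_approx[OF m, of N] unfolding R_def x_def by (rule dvd_diff_power)
  with 1 2 show "fps_X ^ N dvd phi_alt m * euler_f (2 * m) - euler_f m ^ 2"
    by (meson dvd_diff_sym dvd_diff_trans)
qed

section \<open>Supports in residue classes\<close>

text \<open>Stated through nonzero coefficients, the zero series belongs to every class. Since r is
  reduced modulo d, residues simply add under multiplication.\<close>

definition supp_mod :: "nat \<Rightarrow> nat \<Rightarrow> int fps \<Rightarrow> bool" where
  "supp_mod d r f \<longleftrightarrow> (\<forall>n. fps_nth f n \<noteq> 0 \<longrightarrow> n mod d = r mod d)"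

lemma supp_mod_nth_eq_0: "supp_mod d r f \<Longrightarrow> n mod d \<noteq> r mod d \<Longrightarrow> fps_nth f n = 0"
  by (auto simp: supp_mod_def)

lemma supp_mod_dvd: "supp_mod d r f \<Longrightarrow> d' dvd d \<Longrightarrow> supp_mod d' r f"
  unfolding supp_mod_def by (metis mod_mod_cancel)

lemma supp_mod_add: "supp_mod d r f \<Longrightarrow> supp_mod d r g \<Longrightarrow> supp_mod d r (f + g)"
  unfolding supp_mod_def by (metis add_0 fps_add_nth)

lemma supp_mod_diff: "supp_mod d r f \<Longrightarrow> supp_mod d r g \<Longrightarrow> supp_mod d r (f - g)"
  unfolding supp_mod_def by (metis diff_0_right fps_sub_nth)

lemma supp_mod_mult:
  assumes "supp_mod d r f" "supp_mod d s g"
  shows "supp_mod d (r + s) (f * g)"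
  unfolding supp_mod_def
proof (intro allI impI)
  fix n assume "fps_nth (f * g) n \<noteq> 0"
  then obtain i where i: "i \<le> n" "fps_nth f i * fps_nth g (n - i) \<noteq> 0"
    unfolding fps_mult_nth by (metis (no_types, lifting) atLeastAtMost_iff sum.not_neutral_contains_not_neutral)
  then have "i mod d = r mod d" "(n - i) mod d = s mod d"
    using assms by (auto simp: supp_mod_def)
  then have "(i + (n - i)) mod d = (r + s) mod d" by (metis mod_add_cong)
  with i(1) show "n mod d = (r + s) mod d" by simp
qed

lemma supp_mod_0_1 [simp]: "supp_mod d 0 1" "supp_mod d 0 (numeral k)"
  by (auto simp: supp_mod_def numeral_fps_const split: if_splits)

lemma supp_mod_X_power: "supp_mod d n (fps_X ^ n)"
  unfolding supp_mod_def fps_X_power_nth by auto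

lemma supp_mod_mult_0: "supp_mod d 0 f \<Longrightarrow> supp_mod d r g \<Longrightarrow> supp_mod d r (f * g)"
  "supp_mod d r f \<Longrightarrow> supp_mod d 0 g \<Longrightarrow> supp_mod d r (f * g)"
  using supp_mod_mult[of d 0 f r g] supp_mod_mult[of d r f 0 g] by simp_all

lemma supp_mod_power:
  assumes "supp_mod d r f"
  shows "supp_mod d (n * r) (f ^ n)"
proof (induction n)
  case (Suc n)
  then show ?case
    using supp_mod_mult[OF assms Suc] by simp
qed simp

lemma supp_mod_power_0: "supp_mod d 0 f \<Longrightarrow> supp_mod d 0 (f ^ n)"
  using supp_mod_power[of d 0 f n] by simp

lemma supp_mod_prod: "(\<And>i. i \<in> I \<Longrightarrow> supp_mod d 0 (f i)) \<Longrightarrow> supp_mod d 0 (\<Prod>i\<in>I. f i)"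
proof (induction I rule: infinite_finite_induct)
  case (insert i I)
  then show ?case
    using supp_mod_mult_0(1)[of d "f i" 0 "prod f I"] by simp
qed simp_all

text \<open>In the recursion for the coefficient g_n with d not dividing n, each term f_i g_(n-i)
  with i > 0 vanishes: either d does not divide i, or it does not divide the smaller index n -
  i.\<close>

lemma supp_mod_inverse:
  assumes "supp_mod d 0 f" "f * g = 1"
  shows "supp_mod d 0 g"
proof -
  have f0: "fps_nth f 0 \<noteq> 0"
    using arg_cong[OF assms(2), of "\<lambda>h. fps_nth h 0"] by auto
  have "fps_nth g n = 0" if "n mod d \<noteq> 0" for n
    using that
  proof (induction n rule: less_induct)
    case (less n)
    then have "n \<noteq> 0"
      by (metis mod_0)
    then have "0 = fps_nth (f * g) n"
      using assms(2) by simp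
    also have "\<dots> = fps_nth f 0 * fps_nth g n + (\<Sum>i=Suc 0..n. fps_nth f i * fps_nth g (n - i))"
      unfolding fps_mult_nth by (subst sum.atLeast_Suc_atMost) simp_all
    also have "(\<Sum>i=Suc 0..n. fps_nth f i * fps_nth g (n - i)) = 0"
    proof (rule sum.neutral, rule ballI)
      fix i assume i: "i \<in> {Suc 0..n}"
      show "fps_nth f i * fps_nth g (n - i) = 0"
      proof (cases "i mod d = 0")
        case True
        have "(n - i) mod d \<noteq> 0"
        proof
          assume "(n - i) mod d = 0"
          with True i have "(n - i + i) mod d = 0" by (metis add_0 mod_add_eq mod_0)
          with i less.prems show False by simp
        qed
        with less.IH[of "n - i"] i less.prems show ?thesis by auto
      qed (use assms(1) in \<open>auto simp: supp_mod_def\<close>)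
    qed
    finally show ?case using f0 by simp
  qed
  then show ?thesis by (auto simp: supp_mod_def)
qed

lemma supp_mod_gser:
  assumes "\<And>x. x \<in> A \<Longrightarrow> e x mod int d = int r mod int d"
  shows "supp_mod d r (gser A w e)"
  unfolding supp_mod_def
proof (intro allI impI)
  fix n assume "fps_nth (gser A w e) n \<noteq> 0"
  then obtain x where "x \<in> A" "e x = int n"
    unfolding gser_nth by (metis (mono_tags, lifting) mem_Collect_eq sum.neutral)
  with assms[of x] show "n mod d = r mod d"
    by (metis of_nat_eq_iff of_nat_mod)
qed

lemma supp_mod_theta:
  assumes "d dvd m"
  shows "supp_mod d 0 (phi m)" "supp_mod d 0 (phi_alt m)" "supp_mod d 0 (psi m)"
  unfolding phi_def phi_alt_def psi_def using assms by (auto intro!: supp_mod_gser)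

text \<open>Every factor is a polynomial in q^m, and each coefficient of the infinite product is
  already one of a finite product.\<close>

lemma supp_mod_euler_f:
  assumes "d dvd m" "0 < m"
  shows "supp_mod d 0 (euler_f m)"
  unfolding supp_mod_def
proof (intro allI impI)
  fix n assume n: "fps_nth (euler_f m) n \<noteq> 0"
  let ?P = "\<Prod>r<Suc n. 1 - (fps_X ^ m) ^ Suc r :: int fps"
  have "supp_mod d 0 (1 - (fps_X ^ m) ^ Suc r)" for r
  proof (rule supp_mod_diff)
    have "d dvd m * Suc r" using assms(1) by simp
    then show "supp_mod d 0 ((fps_X ^ m) ^ Suc r)"
      using supp_mod_X_power[of d "m * Suc r"]
      unfolding power_mult[symmetric] supp_mod_def by (metis mod_0 mod_0_imp_dvd dvd_imp_mod_0)
  qed simp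
  then have "supp_mod d 0 ?P"
    by (rule supp_mod_prod)
  moreover have "fps_nth ?P n \<noteq> 0"
    using n euler_f_approx[OF assms(2), of "Suc n"] unfolding fps_X_power_dvd_iff by simp
  ultimately show "n mod d = 0 mod d"
    by (auto simp: supp_mod_def)
qed

section \<open>Relations and congruences between theta functions\<close>

lemma euler_f_nonzero [simp]: "0 < m \<Longrightarrow> euler_f m \<noteq> 0"
  using euler_f_has_prod(2)[of m] by auto

lemma unit_inverse:
  fixes f :: "int fps"
  assumes "fps_nth f 0 = 1"
  obtains g where "f * g = 1"
  using fps_right_inverse[of f 1] assms by auto

lemma phi_alt_nonzero [simp]: "0 < m \<Longrightarrow> phi_alt m \<noteq> 0"
  using phi_alt_mult_euler_f[of m] by auto

text \<open>Multiplied by suitable nonzero series, both sides become products of Euler functions via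
  Gauss's formulas and phi(q) phi(-q) = phi(-q^2)^2; the multiplier cancels in an integral
  domain.\<close>

lemma psi_sq:
  assumes "0 < m"
  shows "psi m ^ 2 = phi m * psi (2 * m)"
proof -
  have 2: "phi_alt (2 * m) * euler_f (4 * m) = euler_f (2 * m) ^ 2"
    "psi (2 * m) * euler_f (2 * m) = euler_f (4 * m) ^ 2"
    using phi_alt_mult_euler_f[of "2 * m"] psi_mult_euler_f[of "2 * m"] assms by simp_all
  have "psi m ^ 2 * (phi_alt m * euler_f m ^ 2 * euler_f (2 * m)) =
      phi m * psi (2 * m) * (phi_alt m * euler_f m ^ 2 * euler_f (2 * m))"
    using phi_alt_mult_euler_f[OF assms] psi_mult_euler_f[OF assms] phi_mult_phi_alt[OF assms] 2
    by algebra
  then show ?thesis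
    using assms by simp
qed

text \<open>The sum of the two squares is known, and their difference factors as (phi - phi_alt)(phi
  + phi_alt) = 8 q^m psi(q^(8m)) phi(q^(4m)), which is 8 q^m psi(q^(4m))^2.\<close>

lemma
  assumes "0 < m"
  shows phi_sq: "phi m ^ 2 = phi (2 * m) ^ 2 + 4 * fps_X ^ m * psi (4 * m) ^ 2"
    and phi_alt_sq: "phi_alt m ^ 2 = phi (2 * m) ^ 2 - 4 * fps_X ^ m * psi (4 * m) ^ 2"
proof -
  have 4: "psi (4 * m) ^ 2 = phi (4 * m) * psi (8 * m)"
    using psi_sq[of "4 * m"] assms by simp
  define q :: "int fps" where "q = fps_X ^ m"
  have "2 * phi m ^ 2 = 2 * (phi (2 * m) ^ 2 + 4 * fps_X ^ m * psi (4 * m) ^ 2)"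
    "2 * phi_alt m ^ 2 = 2 * (phi (2 * m) ^ 2 - 4 * fps_X ^ m * psi (4 * m) ^ 2)"
    using phi_sq_add_phi_alt_sq[OF assms] phi_dissect[OF assms] 4
    unfolding q_def[symmetric] by algebra+
  then show "phi m ^ 2 = phi (2 * m) ^ 2 + 4 * fps_X ^ m * psi (4 * m) ^ 2"
    "phi_alt m ^ 2 = phi (2 * m) ^ 2 - 4 * fps_X ^ m * psi (4 * m) ^ 2"
    by (simp_all only: mult_cancel_left) simp_all
qed

text \<open>The indices n and -n pair up, leaving only n = 0.\<close>

lemma phi_parity:
  assumes "0 < m"
  obtains h where "phi m = 1 + 2 * h"
proof -
  define e :: "int \<Rightarrow> int" where "e = (\<lambda>n. int m * n\<^sup>2)"
  have "phi m = gser ({0} \<union> ({0<..} \<union> {..<0})) (\<lambda>_. 1) e"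
    unfolding phi_def e_def by (rule arg_cong[where f = "\<lambda>A. gser A _ _"]) auto
  also have "\<dots> = gser {0} (\<lambda>_. 1) e + gser ({0<..} \<union> {..<0}) (\<lambda>_. 1) e"
    unfolding e_def by (rule gser_Un) (auto intro: loc_fin_square assms)
  also have "gser ({0<..} \<union> {..<0}) (\<lambda>_. 1) e = gser {0<..} (\<lambda>_. 1) e + gser {..<0} (\<lambda>_. 1) e"
    unfolding e_def by (rule gser_Un) (auto intro: loc_fin_square assms)
  also have "gser {..<0} (\<lambda>_. 1) e = gser {0<..} (\<lambda>_. 1) e"
    by (rule gser_reindex_inverse[of _ uminus _ uminus]) (auto simp: e_def)
  also have "gser {0} (\<lambda>_. 1) e = 1"
  proof (rule fps_ext)
    fix k
    have "{x. x = 0 \<and> e x = int k} = (if k = 0 then {0} else {})"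
      by (auto simp: e_def)
    then show "fps_nth (gser {0} (\<lambda>_. 1) e) k = fps_nth 1 k"
      by (simp add: gser_nth)
  qed
  finally have "phi m = 1 + 2 * gser {0<..} (\<lambda>_. 1) e" by simp
  then show ?thesis by (rule that)
qed

lemma phi_alt_parity:
  assumes "0 < m"
  obtains h where "phi_alt m = 1 + 2 * h"
proof -
  obtain h where "phi m = 1 + 2 * h" using assms by (rule phi_parity)
  moreover have "phi_alt m = phi m - 4 * (fps_X ^ m * psi (8 * m))"
    using phi_dissect[OF assms] by simp
  ultimately have "phi_alt m = 1 + 2 * (h - 2 * (fps_X ^ m * psi (8 * m)))"
    by (simp add: algebra_simps)
  then show ?thesis by (rule that)
qed

lemma phi_alt_sq_mod_4:
  assumes "0 < m"
  shows "4 dvd phi_alt m ^ 2 - 1"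
proof -
  obtain h where h: "phi_alt m = 1 + 2 * h" using assms by (rule phi_alt_parity)
  have "phi_alt m ^ 2 - 1 = 4 * (h + h ^ 2)"
    unfolding h by (simp add: power2_eq_square algebra_simps)
  then show ?thesis by simp
qed

lemma phi_sq_mod_4:
  assumes "0 < m"
  shows "4 dvd phi m ^ 2 - 1"
proof -
  obtain h where h: "phi m = 1 + 2 * h" using assms by (rule phi_parity)
  have "phi m ^ 2 - 1 = 4 * (h + h ^ 2)"
    unfolding h by (simp add: power2_eq_square algebra_simps)
  then show ?thesis by simp
qed

text \<open>For t = -3s - 1 one has 2t^2 + t = 1 + 9(2s^2 + s); in the other two classes modulo 3
  the product t(2t + 1) is divisible by 3.\<close>

lemma psi_3_dissect:
  assumes "0 < m"
  obtains a where "supp_mod (3 * m) 0 a" "psi m = a + fps_X ^ m * psi (9 * m)"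
proof -
  define e :: "int \<Rightarrow> int" where "e = (\<lambda>t. int m * (2 * t\<^sup>2 + t))"
  define a where "a = gser {t. t mod 3 \<noteq> 2} (\<lambda>_. 1) e"
  have "psi m = gser {t. t mod 3 = 2} (\<lambda>_. 1) e + a"
    using gser_split[of UNIV e "\<lambda>_. 1" "\<lambda>t. t mod 3 = 2"] loc_fin_triangular[OF assms]
    unfolding a_def e_def psi_def by simp
  also have "gser {t. t mod 3 = 2} (\<lambda>_. 1) e =
      gser UNIV (\<lambda>_. 1) (\<lambda>t. int m + int (9 * m) * (2 * t\<^sup>2 + t))"
  proof (rule gser_reindex_inverse)
    fix s :: int
    show "- 3 * s - 1 \<in> {t. t mod 3 = 2} \<and> - ((- 3 * s - 1 + 1) div 3) = s \<and>
        e (- 3 * s - 1) = int m + int (9 * m) * (2 * s\<^sup>2 + s) \<and> (1 :: int) = 1"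
      by (simp add: e_def power2_eq_square algebra_simps) presburger
  next
    fix t :: int assume "t \<in> {t. t mod 3 = 2}"
    then show "- ((t + 1) div 3) \<in> UNIV \<and> - 3 * (- ((t + 1) div 3)) - 1 = t"
      by simp presburger
  qed
  also have "\<dots> = fps_X ^ m * psi (9 * m)"
    unfolding psi_def
    by (rule gser_X_power[symmetric]) (use loc_fin_triangular[of "9 * m" UNIV] assms in \<open>simp add: loc_fin_def\<close>)
  finally have "psi m = a + fps_X ^ m * psi (9 * m)" by simp
  moreover have "supp_mod (3 * m) 0 a"
    unfolding a_def
  proof (rule supp_mod_gser)
    fix t :: int assume "t \<in> {t. t mod 3 \<noteq> 2}"
    then have "t mod 3 = 0 \<or> (2 * t + 1) mod 3 = 0" by simp presburger
    then have "3 dvd t * (2 * t + 1)" by auto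
    then have "int m * 3 dvd int m * (t * (2 * t + 1))" by (rule mult_dvd_mono[OF dvd_refl])
    then show "e t mod int (3 * m) = int 0 mod int (3 * m)"
      by (simp add: e_def power2_eq_square algebra_simps)
  qed
  ultimately show ?thesis by (rule that[rotated])
qed

lemma euler_f_sq_mod_2:
  assumes "0 < m"
  shows "2 dvd euler_f m ^ 2 - euler_f (2 * m)"
proof -
  obtain h where h: "phi_alt m = 1 + 2 * h" using assms by (rule phi_alt_parity)
  have "euler_f m ^ 2 - euler_f (2 * m) = 2 * (h * euler_f (2 * m))"
    unfolding phi_alt_mult_euler_f[OF assms, symmetric] h by (simp add: algebra_simps)
  then show ?thesis by simp
qed

section \<open>The congruence modulo 3\<close>

lemma numeral_dvd_fps_iff: "(numeral c :: int fps) dvd f \<longleftrightarrow> (\<forall>k. numeral c dvd fps_nth f k)"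
proof
  assume "\<forall>k. numeral c dvd fps_nth f k"
  then have "f = numeral c * Abs_fps (\<lambda>k. fps_nth f k div numeral c)"
    by (intro fps_ext) (simp add: numeral_fps_const)
  then show "numeral c dvd f" by (rule dvdI)
qed (auto simp: numeral_fps_const elim!: dvdE)

text \<open>The congruence (1 - y)^3 = 1 - y^3 modulo 3 holds factor by factor; coefficient k is
  read off from the products of k + 1 factors.\<close>

lemma euler_f_cube_mod_3:
  assumes m: "0 < m"
  shows "3 dvd euler_f m ^ 3 - euler_f (3 * m)"
  unfolding numeral_dvd_fps_iff
proof
  fix k
  define P where "P n = (\<Prod>r<n. 1 - (fps_X ^ m) ^ Suc r :: int fps)" for n
  define R where "R n = (\<Prod>r<n. 1 - (fps_X ^ (3 * m)) ^ Suc r :: int fps)" for n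
  have "3 dvd P n ^ 3 - R n" for n
  proof (induction n)
    case (Suc n)
    define y :: "int fps" where "y = (fps_X ^ m) ^ Suc n"
    have "(fps_X ^ (3 * m)) ^ Suc n = y ^ 3"
      unfolding y_def power_mult[symmetric] by (simp add: algebra_simps)
    moreover have "(1 - y) ^ 3 - (1 - y ^ 3) = 3 * (y ^ 2 - y)"
      by (simp add: power2_eq_square power3_eq_cube algebra_simps)
    then have "3 dvd (1 - y) ^ 3 - (1 - y ^ 3)" by (rule dvdI)
    then have "3 dvd P n ^ 3 * (1 - y) ^ 3 - R n * (1 - y ^ 3)"
      by (rule dvd_diff_mult[OF Suc])
    moreover have "P (Suc n) ^ 3 = P n ^ 3 * (1 - y) ^ 3"
      by (simp only: P_def prod.lessThan_Suc y_def power_mult_distrib)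
    ultimately show ?case
      by (simp only: R_def prod.lessThan_Suc)
  qed (simp add: P_def R_def)
  then have "3 dvd fps_nth (P (Suc k) ^ 3 - R (Suc k)) k"
    by (simp only: numeral_dvd_fps_iff)
  moreover have "fps_X ^ Suc k dvd euler_f m ^ 3 - P (Suc k) ^ 3"
    using euler_f_approx[OF m] unfolding P_def by (rule dvd_diff_power)
  moreover have "fps_X ^ Suc k dvd euler_f (3 * m) - R (Suc k)"
    using m unfolding R_def by (intro euler_f_approx) simp
  ultimately show "3 dvd fps_nth (euler_f m ^ 3 - euler_f (3 * m)) k"
    unfolding fps_X_power_dvd_iff by simp
qed

text \<open>
  The pairs \<open>(a, b)\<close> counted here are the Eisenstein integers \<open>(a + b \<surd>-3) / 2\<close> in a fixed
  nonzero class modulo \<open>\<surd>-3\<close>. Multiplication by a cube root of unity preserves this class and the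
  norm, and permutes the three residues of \<open>b\<close> modulo 3 cyclically.
\<close>

lemma Eisenstein_gser_mod_3:
  assumes "0 < m"
  shows "3 dvd gser {(a, b). a mod 3 = 1 \<and> even (a + b)} (\<lambda>_. 1) (\<lambda>(a, b). int m * a\<^sup>2 + int (3 * m) * b\<^sup>2)"
proof -
  define e :: "int \<times> int \<Rightarrow> int" where "e = (\<lambda>(a, b). int m * a\<^sup>2 + int (3 * m) * b\<^sup>2)"
  define A :: "int \<Rightarrow> (int \<times> int) set" where "A i = {(a, b). a mod 3 = 1 \<and> even (a + b) \<and> b mod 3 = i}" for i
  have "loc_fin (UNIV \<times> UNIV) e"
    unfolding e_def using assms by (intro loc_fin_Times loc_fin_square) simp_all
  then have L: "loc_fin B e" for B
    by (rule loc_fin_subset) simp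
  have rot: "gser (A ((i + 2) mod 3)) (\<lambda>_. 1) e = gser (A i) (\<lambda>_. 1) e" if i: "i \<in> {0, 1, 2}" for i
  proof (rule gser_reindex_inverse)
    \<comment> \<open>These are multiplication of (a + b sqrt(-3))/2 by the cube root of unity (-1 +
      sqrt(-3))/2 and by its conjugate.\<close>
    define h g :: "int \<times> int \<Rightarrow> int \<times> int"
      where "h = (\<lambda>(a, b). ((- a - 3 * b) div 2, (a - b) div 2))"
        and "g = (\<lambda>(a, b). ((- a + 3 * b) div 2, (- a - b) div 2))"
    show "h x \<in> A ((i + 2) mod 3) \<and> g (h x) = x \<and> e (h x) = e x \<and> (1 :: int) = 1" if "x \<in> A i" for x
    proof -
      obtain a b where x: "x = (a, b)" by (cases x)
      have "even (a + b)" using that by (simp add: A_def x)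
      then have "\<exists>c. a = b + 2 * c" by presburger
      then obtain c where c: "a = b + 2 * c" ..
      have h: "h x = (- 2 * b - c, c)" by (simp add: h_def x c)
      have bc: "(b + 2 * c) mod 3 = 1" "b mod 3 = i"
        using that by (auto simp: A_def x c)
      from bc(1) have "(- 2 * b - c) mod 3 = 1" by presburger
      moreover from bc(1) have "c mod 3 = (b + 2) mod 3" by presburger
      then have "c mod 3 = (i + 2) mod 3"
        unfolding bc(2)[symmetric] by (simp add: mod_add_left_eq)
      moreover have "g (h x) = x" unfolding h by (simp add: g_def x c)
      moreover have "e (h x) = e x" unfolding h by (simp add: e_def x c power2_eq_square algebra_simps)
      ultimately show ?thesis unfolding h by (simp add: A_def)
    qed
    show "g x \<in> A i \<and> h (g x) = x" if "x \<in> A ((i + 2) mod 3)" for x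
    proof -
      obtain a b where x: "x = (a, b)" by (cases x)
      have "even (a + b)" using that by (simp add: A_def x)
      then have "\<exists>c. a = - b + 2 * c" by presburger
      then obtain c where c: "a = - b + 2 * c" ..
      have g: "g x = (2 * b - c, - c)" by (simp add: g_def x c)
      have bc: "(- b + 2 * c) mod 3 = 1" "b mod 3 = (i + 2) mod 3"
        using that by (auto simp: A_def x c)
      from bc(1) have "(2 * b - c) mod 3 = 1" by presburger
      moreover from bc(1) have "(- c) mod 3 = (b + 1) mod 3" by presburger
      then have "(- c) mod 3 = (i + 2 + 1) mod 3"
        using bc(2) by (metis mod_add_left_eq)
      then have "(- c) mod 3 = i" using i by auto
      moreover have "h (g x) = x" unfolding g by (simp add: h_def x c)
      ultimately show ?thesis unfolding g by (simp add: A_def)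
    qed
  qed
  have "{(a, b). a mod 3 = 1 \<and> even (a + b)} = A 0 \<union> (A 1 \<union> A 2)"
    by (auto simp: A_def)
  then have "gser {(a, b). a mod 3 = 1 \<and> even (a + b)} (\<lambda>_. 1) e = gser (A 0 \<union> (A 1 \<union> A 2)) (\<lambda>_. 1) e"
    by simp
  also have "\<dots> = gser (A 0) (\<lambda>_. 1) e + gser (A 1 \<union> A 2) (\<lambda>_. 1) e"
    by (rule gser_Un[OF L]) (auto simp: A_def)
  also have "gser (A 1 \<union> A 2) (\<lambda>_. 1) e = gser (A 1) (\<lambda>_. 1) e + gser (A 2) (\<lambda>_. 1) e"
    by (rule gser_Un[OF L]) (auto simp: A_def)
  \<comment> \<open>The rotation identifies class 2 with class 0 and class 1 with class 2, so all
    three series coincide.\<close>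
  also have "gser (A 0) (\<lambda>_. 1) e + \<dots> = 3 * gser (A 0) (\<lambda>_. 1) e"
    using rot[of 0] rot[of 2] by simp
  finally show ?thesis unfolding e_def by simp
qed

text \<open>Negation exchanges the classes 1 and 2 modulo 3, hence the term 2w. In the double sum
  for phi(-q^(3m)) w, \<open>E\<close> collects the pairs with a + b even, where the sign is 1 and
  the Eisenstein argument applies; for a + b odd, a^2 + 3b^2 is odd, which gives the support of
  \<open>T\<close>.\<close>

lemma phi_alt_3_dissect:
  assumes m: "0 < m"
  obtains u w E T where "phi_alt m = u + 2 * w" "supp_mod (3 * m) 0 u" "supp_mod (3 * m) m w"
    "phi_alt (3 * m) * w = E + T" "3 dvd E" "supp_mod (2 * m) m T"
proof -
  define \<sigma> :: "int \<Rightarrow> int" where "\<sigma> n = (if even n then 1 else - 1)" for n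
  define e :: "int \<Rightarrow> int" where "e = (\<lambda>n. int m * n\<^sup>2)"
  define w where "w = gser {n. n mod 3 = 1} \<sigma> e"
  define u where "u = gser {n. n mod 3 = 0} \<sigma> e"
  have L: "loc_fin B e" for B using m unfolding e_def by (rule loc_fin_square)
  have "phi_alt m = gser ({n. n mod 3 = 0} \<union> ({n. n mod 3 = 1} \<union> {n. n mod 3 = 2})) \<sigma> e"
    unfolding phi_alt_def \<sigma>_def[abs_def] e_def by (rule arg_cong[where f = "\<lambda>A. gser A _ _"]) (intro set_eqI, simp, presburger)
  also have "\<dots> = u + gser ({n. n mod 3 = 1} \<union> {n. n mod 3 = 2}) \<sigma> e"
    unfolding u_def by (rule gser_Un[OF L]) auto
  also have "gser ({n. n mod 3 = 1} \<union> {n. n mod 3 = 2}) \<sigma> e = w + gser {n. n mod 3 = 2} \<sigma> e"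
    unfolding w_def by (rule gser_Un[OF L]) auto
  also have "gser {n. n mod 3 = 2} \<sigma> e = w"
    unfolding w_def by (rule gser_reindex_inverse[of _ uminus _ uminus]) (auto simp: e_def \<sigma>_def, presburger+)
  finally have 1: "phi_alt m = u + 2 * w" by simp
  have su: "supp_mod (3 * m) 0 u"
    unfolding u_def
  proof (rule supp_mod_gser)
    fix n :: int assume "n \<in> {n. n mod 3 = 0}"
    then have "int m * 3 dvd int m * (n * n)" by (intro mult_dvd_mono) auto
    then show "e n mod int (3 * m) = int 0 mod int (3 * m)"
      by (simp add: e_def power2_eq_square mult.commute)
  qed
  have sw: "supp_mod (3 * m) m w"
    unfolding w_def
  proof (rule supp_mod_gser)
    fix n :: int assume "n \<in> {n. n mod 3 = 1}"
    then have "3 dvd n - 1" by simp presburger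
    then have "int m * 3 dvd int m * ((n - 1) * (n + 1))" by (intro mult_dvd_mono) auto
    also have "int m * ((n - 1) * (n + 1)) = e n - int m"
      by (simp add: e_def power2_eq_square algebra_simps)
    finally show "e n mod int (3 * m) = int m mod int (3 * m)"
      by (simp only: mod_eq_dvd_iff of_nat_mult of_nat_numeral mult.commute)
  qed
  define e3 :: "int \<times> int \<Rightarrow> int" where "e3 = (\<lambda>(a, b). int m * a\<^sup>2 + int (3 * m) * b\<^sup>2)"
  define B :: "(int \<times> int) set" where "B = {n. n mod 3 = 1} \<times> UNIV"
  define E where "E = gser {(a, b). a mod 3 = 1 \<and> even (a + b)} (\<lambda>_. 1) e3"
  define T where "T = gser {(a, b). a mod 3 = 1 \<and> odd (a + b)} (\<lambda>(a, b). \<sigma> a * \<sigma> b) e3"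
  have LB: "loc_fin B e3"
    using loc_fin_Times[OF L[of "{n. n mod 3 = 1}"] loc_fin_square[of "3 * m" UNIV]] m
    unfolding B_def e3_def e_def by simp
  have "phi_alt (3 * m) * w = w * phi_alt (3 * m)" by (rule mult.commute)
  also have "\<dots> = gser B (\<lambda>(a, b). \<sigma> a * \<sigma> b) e3"
    unfolding w_def phi_alt_def B_def e3_def e_def \<sigma>_def[abs_def]
    using m by (intro gser_mult loc_fin_square) simp_all
  also have "\<dots> = gser {x \<in> B. even (fst x + snd x)} (\<lambda>(a, b). \<sigma> a * \<sigma> b) e3 +
      gser {x \<in> B. \<not> even (fst x + snd x)} (\<lambda>(a, b). \<sigma> a * \<sigma> b) e3"
    by (rule gser_split[OF LB])
  also have "gser {x \<in> B. even (fst x + snd x)} (\<lambda>(a, b). \<sigma> a * \<sigma> b) e3 = E"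
    unfolding E_def by (rule gser_reindex[of "\<lambda>x. x"]) (auto simp: B_def \<sigma>_def)
  also have "{x \<in> B. \<not> even (fst x + snd x)} = {(a, b). a mod 3 = 1 \<and> odd (a + b)}"
    by (auto simp: B_def)
  finally have 2: "phi_alt (3 * m) * w = E + T" unfolding T_def .
  have 3: "3 dvd E"
    unfolding E_def e3_def by (rule Eisenstein_gser_mod_3[OF m])
  have "supp_mod (2 * m) m T"
    unfolding T_def
  proof (rule supp_mod_gser)
    fix x :: "int \<times> int" assume x: "x \<in> {(a, b). a mod 3 = 1 \<and> odd (a + b)}"
    obtain a b where ab: "x = (a, b)" by (cases x)
    have "even (a\<^sup>2 + 3 * b\<^sup>2 - 1)" using x by (auto simp: ab)
    then have "int m * 2 dvd int m * (a\<^sup>2 + 3 * b\<^sup>2 - 1)" by (intro mult_dvd_mono) auto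
    also have "int m * (a\<^sup>2 + 3 * b\<^sup>2 - 1) = e3 x - int m"
      by (simp add: e3_def ab algebra_simps)
    finally show "e3 x mod int (2 * m) = int m mod int (2 * m)"
      by (simp only: mod_eq_dvd_iff of_nat_mult of_nat_numeral mult.commute)
  qed
  with 1 su sw 2 3 show ?thesis by (rule that)
qed

text \<open>Modulo 3, f_3^3 may be replaced by f_9; then psi(q^9) f_9 = f_18^2, and f_18 is
  congruent to f_6^3.\<close>

lemma psi_9_mod_3: "3 dvd psi 9 * euler_f 3 ^ 3 - euler_f 6 ^ 6"
proof -
  have "psi 9 * euler_f 9 = euler_f 18 ^ 2"
    using psi_mult_euler_f[of 9] by simp
  moreover obtain h where "euler_f 3 ^ 3 - euler_f 9 = 3 * h"
    using euler_f_cube_mod_3[of 3] by auto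
  moreover obtain k where "euler_f 6 ^ 3 - euler_f 18 = 3 * k"
    using euler_f_cube_mod_3[of 6] by auto
  ultimately have "psi 9 * euler_f 3 ^ 3 - euler_f 6 ^ 6 = 3 * (psi 9 * h - 2 * k * euler_f 18 - 3 * k ^ 2)"
    by algebra
  then show ?thesis by (rule dvdI)
qed

text \<open>Modulo 3, 1/(f_1^2 f_2^2) = f_1 f_2/(f_1^3 f_2^3) is congruent to f_1 f_2/(f_3 f_6), and
  f_1 f_2 = phi(-q) psi(q).\<close>

lemma CP3_mod_3:
  "3 dvd Abs_fps CP3 - euler_f 3 ^ 5 * euler_f 6 ^ 5 * phi_alt 1 * psi 1"
proof -
  define C where "C = Abs_fps CP3"
  have C: "C * (euler_f 1 ^ 2 * euler_f 2 ^ 2) = euler_f 3 ^ 6 * euler_f 6 ^ 6"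
    unfolding C_def by (rule CP3_gf_eq)
  \<comment> \<open>A congruence multiplied by f_3 f_6 can be undone because this series is a
    unit.\<close>
  obtain G where G: "(euler_f 3 * euler_f 6) * G = 1"
    by (rule unit_inverse[of "euler_f 3 * euler_f 6"]) (simp_all add: euler_f_has_prod(2))
  obtain h where h: "euler_f 1 ^ 3 - euler_f 3 = 3 * h"
    using euler_f_cube_mod_3[of 1] by auto
  obtain k where k: "euler_f 2 ^ 3 - euler_f 6 = 3 * k"
    using euler_f_cube_mod_3[of 2] by auto
  have "phi_alt 1 * euler_f 2 = euler_f 1 ^ 2" "psi 1 * euler_f 1 = euler_f 2 ^ 2"
    using phi_alt_mult_euler_f[of 1] psi_mult_euler_f[of 1] by simp_all
  then have "phi_alt 1 * psi 1 * (euler_f 1 * euler_f 2) = euler_f 1 * euler_f 2 * (euler_f 1 * euler_f 2)"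
    by algebra
  then have pp: "phi_alt 1 * psi 1 = euler_f 1 * euler_f 2" by simp
  have "(C - euler_f 3 ^ 5 * euler_f 6 ^ 5 * (euler_f 1 * euler_f 2)) * (euler_f 3 * euler_f 6) =
      3 * (C * (3 * h * k - h * euler_f 2 ^ 3 - k * euler_f 1 ^ 3))"
    using C h k by algebra
  then have "C - euler_f 3 ^ 5 * euler_f 6 ^ 5 * (euler_f 1 * euler_f 2) =
      3 * (C * (3 * h * k - h * euler_f 2 ^ 3 - k * euler_f 1 ^ 3) * G)"
    using G by algebra
  then show ?thesis
    unfolding C_def[symmetric] mult.assoc pp by simp
qed

text \<open>Exponents 6n + 5 are 2 modulo 3 and odd. The first property isolates one product of the
  3-dissections of phi(-q) and psi(q); modulo 3 that product is 2 q f_6^12 (E + T), where 3 divides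
  \<open>E\<close> and the \<open>T\<close> part has only even exponents.\<close>

lemma CP3_6n5_mod_3: "3 dvd CP3 (6 * n + 5)"
proof -
  define C where "C = Abs_fps CP3"
  obtain u w E T where *: "phi_alt 1 = u + 2 * w" "supp_mod (3 * 1) 0 u" "supp_mod (3 * 1) 1 w"
    "phi_alt (3 * 1) * w = E + T" "3 dvd E" "supp_mod (2 * 1) 1 T"
    using zero_less_one by (rule phi_alt_3_dissect)
  note u = *(1-3)[unfolded mult_1_right] and ET = *(4-6)[unfolded mult_1_right]
  obtain a where **: "supp_mod (3 * 1) 0 a" "psi 1 = a + fps_X ^ 1 * psi (9 * 1)"
    using zero_less_one by (rule psi_3_dissect)
  note a = **[unfolded mult_1_right power_one_right]
  define M where "M = euler_f 3 ^ 5 * euler_f 6 ^ 5"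
  have M: "supp_mod 3 0 M"
    unfolding M_def by (intro supp_mod_mult_0 supp_mod_power_0 supp_mod_euler_f) auto
  \<comment> \<open>\<open>V\<close> collects the products with exponents 0 or 1 modulo 3; the one
    left out is 2 M w q psi(q^9).\<close>
  define V where "V = M * u * a + M * u * fps_X * psi 9 + 2 * M * w * a"
  have sV: "fps_nth V (6 * n + 5) = 0"
  proof -
    have X: "supp_mod 3 1 fps_X" using supp_mod_X_power[of 3 1] by simp
    have "supp_mod 3 0 (M * u * a)"
      using M u(2) a(1) by (intro supp_mod_mult_0)
    moreover have "supp_mod 3 1 (M * u * fps_X * psi 9)"
      using M u(2) X by (intro supp_mod_mult_0 supp_mod_theta) auto
    moreover have "supp_mod 3 1 (2 * M * w * a)"
      using M u(3) a(1) by (intro supp_mod_mult_0) auto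
    moreover have "(6 * n + 5) mod 3 = 2" by presburger
    ultimately show ?thesis
      unfolding V_def by (simp add: supp_mod_nth_eq_0)
  qed
  have sT: "fps_nth (2 * fps_X * euler_f 6 ^ 12 * T) (6 * n + 5) = 0"
  proof -
    have "supp_mod 2 (1 + 1) (fps_X * euler_f 6 ^ 12 * T)"
      using supp_mod_X_power[of 2 1] ET(3)
      by (intro supp_mod_mult[of _ 1] supp_mod_mult_0 supp_mod_power_0 supp_mod_euler_f) auto
    then have "supp_mod 2 (1 + 1) (2 * (fps_X * euler_f 6 ^ 12 * T))"
      by (rule supp_mod_mult_0(1)[OF supp_mod_0_1(2)])
    moreover have "(6 * n + 5) mod 2 \<noteq> (1 + 1) mod 2" by presburger
    ultimately show ?thesis
      unfolding mult.assoc by (rule supp_mod_nth_eq_0)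
  qed
  have "3 dvd C - (V + 2 * fps_X * euler_f 6 ^ 12 * T)"
  proof -
    obtain h where h: "C - M * phi_alt 1 * psi 1 = 3 * h"
      using CP3_mod_3 unfolding C_def M_def by (auto simp: mult.assoc)
    obtain k where k: "psi 9 * euler_f 3 ^ 3 - euler_f 6 ^ 6 = 3 * k"
      using psi_9_mod_3 by auto
    obtain E' where E: "E = 3 * E'" using ET(2) by auto
    have F: "phi_alt 3 * euler_f 6 = euler_f 3 ^ 2"
      using phi_alt_mult_euler_f[of 3] by simp
    \<comment> \<open>The factor f_3^3 is split off to absorb psi(q^9); the remaining f_3^2 equals
      phi(-q^3) f_6, the theta function that pairs with \<open>w\<close>.\<close>
    have "M * psi 9 = euler_f 3 ^ 2 * euler_f 6 ^ 5 * (psi 9 * euler_f 3 ^ 3)"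
      unfolding M_def by algebra
    also have "psi 9 * euler_f 3 ^ 3 = euler_f 6 ^ 6 + 3 * k"
      using k by (simp add: diff_eq_eq add.commute)
    also have "euler_f 3 ^ 2 * euler_f 6 ^ 5 * (euler_f 6 ^ 6 + 3 * k) =
        phi_alt 3 * euler_f 6 ^ 12 + 3 * (euler_f 3 ^ 2 * euler_f 6 ^ 5 * k)"
      using F by algebra
    finally have M9: "M * psi 9 = phi_alt 3 * euler_f 6 ^ 12 + 3 * (euler_f 3 ^ 2 * euler_f 6 ^ 5 * k)" .
    define Z where "Z = euler_f 6 ^ 12"
    define Y where "Y = euler_f 3 ^ 2 * euler_f 6 ^ 5 * k"
    have "C - (V + 2 * fps_X * Z * T) = 3 * (h + 2 * fps_X * w * Y + 2 * fps_X * Z * E')"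
      using h E ET(1) a(2) u(1) M9 unfolding V_def Z_def[symmetric] Y_def[symmetric] by algebra
    then have "C - (V + 2 * fps_X * euler_f 6 ^ 12 * T) = 3 * (h + 2 * fps_X * w * Y + 2 * fps_X * Z * E')"
      unfolding Z_def .
    then show ?thesis by (rule dvdI)
  qed
  then have "3 dvd fps_nth (C - (V + 2 * fps_X * euler_f 6 ^ 12 * T)) (6 * n + 5)"
    by (simp only: numeral_dvd_fps_iff)
  then show ?thesis
    using sV sT by (simp add: C_def)
qed

section \<open>The congruences modulo 16 and 32\<close>

lemma euler_f_inverse:
  assumes "d dvd m" "0 < m"
  obtains g where "euler_f m * g = 1" "supp_mod d 0 g"
proof -
  obtain g where g: "euler_f m * g = 1"
    using euler_f_has_prod(2)[of m] assms by (auto intro: unit_inverse)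
  moreover have "supp_mod d 0 g"
    using supp_mod_euler_f[OF assms] g by (rule supp_mod_inverse)
  ultimately show ?thesis by (rule that)
qed

lemma phi_alt_inverse:
  assumes "d dvd m" "0 < m"
  obtains g where "phi_alt m * g = 1" "supp_mod d 0 g"
proof -
  have "fps_nth (phi_alt m * euler_f (2 * m)) 0 = fps_nth (euler_f m ^ 2) 0"
    using assms by (simp only: phi_alt_mult_euler_f)
  then have "fps_nth (phi_alt m) 0 = 1"
    using assms euler_f_has_prod(2)[of m] euler_f_has_prod(2)[of "2 * m"] by (simp add: fps_nth_power_0)
  then obtain g where g: "phi_alt m * g = 1"
    by (rule unit_inverse)
  moreover have "supp_mod d 0 g"
    using supp_mod_theta(2)[OF assms(1)] g by (rule supp_mod_inverse)
  ultimately show ?thesis by (rule that)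
qed

text \<open>The generating function is (phi(-q^3)^2 psi(q) psi(q^3))^2 f_6^6 / f_2^6. The base of
  the outer square is \<open>e + fps_X * p\<close> with \<open>e\<close> and \<open>p\<close> even
  series, so the odd part is the cross term 2 q e p, multiplied by f_6^6 / f_2^6.\<close>

lemma CP3_odd_part:
  assumes J: "phi_alt 4 * J = 1" and I: "euler_f 4 * I = 1"
  obtains B where "supp_mod 2 0 B"
    "Abs_fps CP3 = B + 2 * fps_X * (euler_f 12 ^ 6 * I ^ 3 * J ^ 4) *
      (phi 2 ^ 2 * phi_alt 12 ^ 6 * psi 4 - 4 * fps_X ^ 4 * (phi 2 * phi_alt 6) ^ 3 * psi 12 ^ 3)"
proof -
  define C where "C = Abs_fps CP3"
  define e where "e = phi 6 ^ 3 * psi 4 - 4 * fps_X ^ 4 * phi 2 * psi 12 ^ 3"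
  define p where "p = phi_alt 2 * phi_alt 6 * psi 6 ^ 2"
  obtain H where H: "euler_f 2 * H = 1" "supp_mod 2 0 H"
    by (rule euler_f_inverse[of 2 2]) simp_all
  have C: "C * (euler_f 1 ^ 2 * euler_f 2 ^ 2) = euler_f 3 ^ 6 * euler_f 6 ^ 6"
    unfolding C_def by (rule CP3_gf_eq)
  have F: "phi_alt 2 * euler_f 4 = euler_f 2 ^ 2" "phi_alt 3 * euler_f 6 = euler_f 3 ^ 2"
      "phi_alt 6 * euler_f 12 = euler_f 6 ^ 2" "psi 1 * euler_f 1 = euler_f 2 ^ 2"
      "psi 3 * euler_f 3 = euler_f 6 ^ 2" "psi 6 * euler_f 6 = euler_f 12 ^ 2"
    using phi_alt_mult_euler_f[of 2] phi_alt_mult_euler_f[of 3] phi_alt_mult_euler_f[of 6]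
      psi_mult_euler_f[of 1] psi_mult_euler_f[of 3] psi_mult_euler_f[of 6] by simp_all
  have "phi_alt 3 ^ 2 * (psi 1 * psi 3) * euler_f 1 * (euler_f 6 ^ 2 * euler_f 3) =
      euler_f 3 ^ 3 * euler_f 2 ^ 2 * (euler_f 6 ^ 2 * euler_f 3)"
    using F(2,4,5) by algebra
  then have g: "phi_alt 3 ^ 2 * (psi 1 * psi 3) * euler_f 1 = euler_f 3 ^ 3 * euler_f 2 ^ 2"
    by simp
  have "C * euler_f 2 ^ 6 * euler_f 1 ^ 2 = (phi_alt 3 ^ 2 * (psi 1 * psi 3)) ^ 2 * euler_f 6 ^ 6 * euler_f 1 ^ 2"
    using C g by algebra
  then have C2: "C * euler_f 2 ^ 6 = (phi_alt 3 ^ 2 * (psi 1 * psi 3)) ^ 2 * euler_f 6 ^ 6"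
    by simp
  have "psi 1 * psi 3 = phi 6 * psi 4 + fps_X * phi 2 * psi 12"
    using psi_mult_psi_3[of 1] by simp
  moreover have "phi_alt 3 ^ 2 = phi 6 ^ 2 - 4 * fps_X ^ 3 * psi 12 ^ 2"
    using phi_alt_sq[of 3] by simp
  moreover have "psi 6 ^ 2 = phi 6 * psi 12"
    using psi_sq[of 6] by simp
  \<comment> \<open>The cross terms of the two dissected products add up to the 2-dissection of
    psi(q^4) psi(q^12). This makes the odd part of the base collapse to the single product
    \<open>p\<close>.\<close>
  moreover have "phi 2 * phi 6 - phi_alt 2 * phi_alt 6 = 4 * fps_X ^ 2 * psi 4 * psi 12"
  proof -
    have "phi 2 = phi 8 + 2 * fps_X ^ 2 * psi 16" "phi_alt 2 = phi 8 - 2 * fps_X ^ 2 * psi 16"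
      "phi 6 = phi 24 + 2 * fps_X ^ 6 * psi 48" "phi_alt 6 = phi 24 - 2 * fps_X ^ 6 * psi 48"
      using phi_dissect[of 2] phi_dissect[of 6] by simp_all
    moreover have "psi 4 * psi 12 = phi 24 * psi 16 + fps_X ^ 4 * phi 8 * psi 48"
      using psi_mult_psi_3[of 4] by simp
    ultimately show ?thesis by algebra
  qed
  ultimately have "phi_alt 3 ^ 2 * (psi 1 * psi 3) = e + fps_X * p"
    unfolding e_def p_def by algebra
  with C2 have C3: "C * euler_f 2 ^ 6 = (e + fps_X * p) ^ 2 * euler_f 6 ^ 6" by simp
  define B where "B = H ^ 6 * euler_f 6 ^ 6 * (e ^ 2 + fps_X ^ 2 * p ^ 2)"
  have "C = B + 2 * fps_X * e * (p * euler_f 6 ^ 6 * H ^ 6)"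
    using C3 H(1) unfolding B_def by algebra
  moreover have "p * euler_f 6 ^ 6 * H ^ 6 = phi_alt 6 ^ 3 * euler_f 12 ^ 6 * I ^ 3 * J ^ 4 * phi 2 ^ 2"
  proof -
    have "p * euler_f 4 * (euler_f 6 ^ 2 * euler_f 12) = euler_f 12 ^ 3 * euler_f 2 ^ 2 * (euler_f 6 ^ 2 * euler_f 12)"
      using F(1,3,6) unfolding p_def by algebra
    then have p: "p * euler_f 4 = euler_f 12 ^ 3 * euler_f 2 ^ 2" by simp
    have "phi 2 * phi_alt 2 = phi_alt 4 ^ 2"
      using phi_mult_phi_alt[of 2] by simp
    \<comment> \<open>Here 1/f_2^4 is traded for phi(q^2)^2 times series in q^4, so that phi(q^2)
      alone has to be dissected further.\<close>
    then have "H ^ 4 = phi 2 ^ 2 * J ^ 4 * I ^ 2"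
      using F(1) I J H(1) by algebra
    then show ?thesis
      using p F(3) I H(1) by algebra
  qed
  moreover have "phi 6 * phi_alt 6 = phi_alt 12 ^ 2"
    using phi_mult_phi_alt[of 6] by simp
  ultimately have "C = B + 2 * fps_X * (euler_f 12 ^ 6 * I ^ 3 * J ^ 4) *
      (phi 2 ^ 2 * phi_alt 12 ^ 6 * psi 4 - 4 * fps_X ^ 4 * (phi 2 * phi_alt 6) ^ 3 * psi 12 ^ 3)"
    unfolding e_def by algebra
  moreover have "supp_mod 2 0 B"
  proof -
    have X: "supp_mod 2 0 (fps_X ^ k)" if "even k" for k
      using supp_mod_X_power[of 2 k] that by (simp add: supp_mod_def)
    show ?thesis
      unfolding B_def e_def p_def
      by (intro supp_mod_mult_0 supp_mod_power_0 supp_mod_add supp_mod_diff supp_mod_theta supp_mod_euler_f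
          supp_mod_0_1 H(2) X) simp_all
  qed
  ultimately show ?thesis
    unfolding C_def by (intro that)
qed

text \<open>The odd part is dissected once more through phi(q^2) and phi(-q^6). Its terms in 4n + 3
  carry a factor 8, so the cofactor matters only modulo 4. Writing psi(q^8) = a + b by exponents
  modulo 3, the squares a^2 and b^2 lead to \<open>K1\<close> and \<open>K2\<close>, and 2ab to
  \<open>L\<close>.\<close>

lemma CP3_dissection:
  obtains A B K1 K2 L U where
    "Abs_fps CP3 = A + B + 8 * K1 + 8 * K2 + 16 * L + 32 * U"
    "supp_mod 2 0 A" "supp_mod 4 1 B" "supp_mod 12 3 K1" "supp_mod 12 7 K2" "supp_mod 24 11 L"
proof -
  obtain J where J: "phi_alt 4 * J = 1" "supp_mod 4 0 J"
    by (rule phi_alt_inverse[of 4 4]) simp_all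
  obtain I where I: "euler_f 4 * I = 1" "supp_mod 4 0 I"
    by (rule euler_f_inverse[of 4 4]) simp_all
  obtain A where A: "supp_mod 2 0 A" "Abs_fps CP3 = A + 2 * fps_X * (euler_f 12 ^ 6 * I ^ 3 * J ^ 4) *
      (phi 2 ^ 2 * phi_alt 12 ^ 6 * psi 4 - 4 * fps_X ^ 4 * (phi 2 * phi_alt 6) ^ 3 * psi 12 ^ 3)"
    using J(1) I(1) by (rule CP3_odd_part)
  define G where "G = euler_f 12 ^ 6"
  define N where "N = G * I ^ 3 * J ^ 4"
  define ev where "ev = phi 8 * phi 24 - 4 * fps_X ^ 8 * psi 16 * psi 48"
  have X: "supp_mod d 0 (fps_X ^ k)" if "d dvd k" for d k
    using supp_mod_X_power[of d k] that by (simp add: supp_mod_def)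
  obtain s where s: "phi 2 ^ 2 - 1 = 4 * s" using phi_sq_mod_4[of 2] by auto
  obtain t where t: "phi_alt 6 ^ 2 - 1 = 4 * t" using phi_alt_sq_mod_4[of 6] by auto
  have phi2: "phi 2 ^ 2 = phi 4 ^ 2 + 4 * fps_X ^ 2 * psi 8 ^ 2"
    using phi_sq[of 2] by simp
  have ev: "phi 2 * phi_alt 6 = ev + 2 * fps_X ^ 2 * psi 4 * psi 12 - 4 * fps_X ^ 6 * phi 8 * psi 48"
  proof -
    have "phi 2 = phi 8 + 2 * fps_X ^ 2 * psi 16" "phi_alt 6 = phi 24 - 2 * fps_X ^ 6 * psi 48"
      using phi_dissect[of 2] phi_dissect[of 6] by simp_all
    moreover have "psi 4 * psi 12 = phi 24 * psi 16 + fps_X ^ 4 * phi 8 * psi 48"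
      using psi_mult_psi_3[of 4] by simp
    ultimately show ?thesis unfolding ev_def by algebra
  qed
  \<comment> \<open>As phi(q^2)^2 and phi(-q^6)^2 are 1 modulo 4, the cube is congruent to its base;
    the prefactor 8 turns the error \<open>4 * w\<close> into a multiple of 32.\<close>
  obtain w where w: "(phi 2 * phi_alt 6) ^ 3 = ev + 2 * fps_X ^ 2 * psi 4 * psi 12 + 4 * w"
  proof
    have "(phi 2 * phi_alt 6) ^ 3 = (1 + 4 * s) * (1 + 4 * t) * (phi 2 * phi_alt 6)"
      using s t by algebra
    also have "\<dots> = phi 2 * phi_alt 6 + 4 * ((s + t + 4 * s * t) * (phi 2 * phi_alt 6))"
      by algebra
    also have "phi 2 * phi_alt 6 + 4 * ((s + t + 4 * s * t) * (phi 2 * phi_alt 6)) =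
       ev + 2 * fps_X ^ 2 * psi 4 * psi 12 +
         4 * ((s + t + 4 * s * t) * (phi 2 * phi_alt 6) - fps_X ^ 6 * phi 8 * psi 48)"
      using ev by algebra
    finally show "(phi 2 * phi_alt 6) ^ 3 = ev + 2 * fps_X ^ 2 * psi 4 * psi 12 +
         4 * ((s + t + 4 * s * t) * (phi 2 * phi_alt 6) - fps_X ^ 6 * phi 8 * psi 48)" .
  qed
  define B where "B = 2 * (fps_X * (N * (phi 4 ^ 2 * phi_alt 12 ^ 6 * psi 4 - 4 * fps_X ^ 4 * ev * psi 12 ^ 3)))"
  define R where "R = psi 8 ^ 2 * phi_alt 12 ^ 6 - 2 * fps_X ^ 4 * psi 12 ^ 4"
  have 1: "Abs_fps CP3 = A + B + 8 * fps_X ^ 3 * (N * psi 4) * R - 32 * (fps_X ^ 5 * N * w * psi 12 ^ 3)"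
    unfolding A(2) G_def[symmetric] N_def[symmetric] w phi2 B_def R_def by algebra
  have sB: "supp_mod 4 1 B"
  proof -
    have "supp_mod 4 0 (N * (phi 4 ^ 2 * phi_alt 12 ^ 6 * psi 4 - 4 * fps_X ^ 4 * ev * psi 12 ^ 3))"
      unfolding N_def G_def ev_def
      by (intro supp_mod_mult_0 supp_mod_power_0 supp_mod_diff supp_mod_theta supp_mod_euler_f
          supp_mod_0_1 J(2) I(2) X) simp_all
    moreover have "supp_mod 4 1 fps_X" using supp_mod_X_power[of 4 1] by simp
    ultimately have "supp_mod 4 1 (fps_X * (N * (phi 4 ^ 2 * phi_alt 12 ^ 6 * psi 4 - 4 * fps_X ^ 4 * ev * psi 12 ^ 3)))"
      by (rule supp_mod_mult_0(2)[rotated])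
    then show ?thesis
      unfolding B_def by (rule supp_mod_mult_0(1)[OF supp_mod_0_1(2)])
  qed
  \<comment> \<open>This is psi(q) phi(-q)^2 = f_1^3 at q^4; it removes the inverse Euler products
    in favour of \<open>J\<close>, whose sixth power is 1 modulo 4.\<close>
  have "psi 4 * I ^ 3 = J ^ 2"
  proof -
    have "phi_alt 4 * euler_f 8 = euler_f 4 ^ 2" "psi 4 * euler_f 4 = euler_f 8 ^ 2"
      using phi_alt_mult_euler_f[of 4] psi_mult_euler_f[of 4] by simp_all
    then have "psi 4 * phi_alt 4 ^ 2 * (euler_f 4 * euler_f 8 ^ 2) = euler_f 4 ^ 3 * (euler_f 4 * euler_f 8 ^ 2)"
      by algebra
    then have "psi 4 * phi_alt 4 ^ 2 = euler_f 4 ^ 3" by simp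
    then show ?thesis using I(1) J(1) by algebra
  qed
  then have 2: "N * psi 4 = G * J ^ 6"
    unfolding N_def by algebra
  have J6: "4 dvd J ^ 6 - 1"
  proof -
    have "4 dvd (phi_alt 4 ^ 2) ^ 3 - 1 ^ 3"
      using phi_alt_sq_mod_4[of 4] by (intro dvd_diff_power) simp
    then have "4 dvd - (J ^ 6 * ((phi_alt 4 ^ 2) ^ 3 - 1 ^ 3))" by simp
    also have "- (J ^ 6 * ((phi_alt 4 ^ 2) ^ 3 - 1 ^ 3)) = J ^ 6 - 1"
      using J(1) by (simp add: right_diff_distrib power_mult[symmetric] power_mult_distrib[symmetric] mult.commute)
    finally show ?thesis .
  qed
  have P6: "4 dvd phi_alt 12 ^ 6 - 1"
  proof -
    have "4 dvd (phi_alt 12 ^ 2) ^ 3 - 1 ^ 3"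
      using phi_alt_sq_mod_4[of 12] by (intro dvd_diff_power) simp
    then show ?thesis by (simp add: power_mult[symmetric])
  qed
  obtain k where k: "J ^ 6 * R - (psi 8 ^ 2 - 2 * fps_X ^ 4 * psi 12 ^ 4) = 4 * k"
  proof -
    obtain j p where "J ^ 6 - 1 = 4 * j" "phi_alt 12 ^ 6 - 1 = 4 * p"
      using J6 P6 by (elim dvdE)
    then have "J ^ 6 * R - (psi 8 ^ 2 - 2 * fps_X ^ 4 * psi 12 ^ 4) = 4 * (j * R + psi 8 ^ 2 * p)"
      unfolding R_def by algebra
    then show ?thesis by (rule that)
  qed
  obtain a where a: "supp_mod (3 * 8) 0 a" "psi 8 = a + fps_X ^ 8 * psi (9 * 8)"
    using psi_3_dissect[of 8] by auto
  define b where "b = fps_X ^ 8 * psi 72"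
  have ab: "psi 8 = a + b" using a(2) by (simp add: b_def)
  have sa: "supp_mod 24 0 a" using a(1) by simp
  have sb: "supp_mod 24 8 b"
    unfolding b_def by (intro supp_mod_mult_0(2) supp_mod_X_power supp_mod_theta) simp
  \<comment> \<open>The cross term 2ab has coefficient 16, so its cofactor may be changed modulo 2;
    f_24^3 in place of f_12^6 refines the support from modulus 12 to 24.\<close>
  have "2 dvd (euler_f 12 ^ 2) ^ 3 - euler_f 24 ^ 3"
    using euler_f_sq_mod_2[of 12] by (intro dvd_diff_power) simp
  then obtain v where v: "G - euler_f 24 ^ 3 = 2 * v"
    by (auto simp: G_def power_mult[symmetric])
  define K1 where "K1 = fps_X ^ 3 * (G * a ^ 2)"
  define K2 where "K2 = fps_X ^ 3 * b ^ 2 * G - 2 * (fps_X ^ 7 * (G * psi 12 ^ 4))"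
  define L where "L = (fps_X ^ 3 * b) * (euler_f 24 ^ 3 * a)"
  define U where "U = fps_X ^ 3 * (G * k + v * a * b) - fps_X ^ 5 * N * w * psi 12 ^ 3"
  have "Abs_fps CP3 = A + B + 8 * K1 + 8 * K2 + 16 * L + 32 * U"
    using 1 2 k ab v unfolding K1_def K2_def L_def U_def by algebra
  moreover have sG: "supp_mod 12 0 G"
    unfolding G_def by (intro supp_mod_power_0 supp_mod_euler_f) simp_all
  moreover have "supp_mod 12 3 K1"
    unfolding K1_def
    by (intro supp_mod_mult_0(2) supp_mod_X_power supp_mod_mult_0 sG supp_mod_power_0 supp_mod_dvd[OF sa]) simp
  moreover have "supp_mod 12 7 K2"
  proof -
    \<comment> \<open>The exponent class 3 + 16 = 19 is 7 modulo 12, the class of the psi(q^12)^4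
      term as well.\<close>
    have "supp_mod 12 (3 + 2 * 8) (fps_X ^ 3 * b ^ 2)"
      by (intro supp_mod_mult supp_mod_X_power supp_mod_power supp_mod_dvd[OF sb]) simp
    then have "supp_mod 12 7 (fps_X ^ 3 * b ^ 2)"
      by (simp add: supp_mod_def)
    then show ?thesis
      unfolding K2_def
      by (intro supp_mod_diff supp_mod_mult_0(2)[OF _ sG] supp_mod_mult_0(1)[OF supp_mod_0_1(2)]
         supp_mod_mult_0(2)[OF supp_mod_X_power] supp_mod_mult_0(1)[OF sG] supp_mod_power_0 supp_mod_theta) simp_all
  qed
  moreover have "supp_mod 24 11 L"
  proof -
    have "supp_mod 24 (3 + 8) (fps_X ^ 3 * b)"
      by (intro supp_mod_mult supp_mod_X_power sb)
    moreover have "supp_mod 24 0 (euler_f 24 ^ 3 * a)"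
      by (intro supp_mod_mult_0(1)[OF _ sa] supp_mod_power_0 supp_mod_euler_f) simp_all
    ultimately show ?thesis
      unfolding L_def using supp_mod_mult_0(2) by fastforce
  qed
  ultimately show ?thesis using A(1) sB by (intro that)
qed

text \<open>A number that is 11 modulo 12 is odd, 3 modulo 4, and neither 3 nor 7 modulo 12, so only
  16 L + 32 U contributes; \<open>L\<close> in turn vanishes at 23 modulo 24.\<close>

lemma
  shows CP3_mod_16: "16 dvd CP3 (12 * n + 11)"
    and CP3_mod_32: "32 dvd CP3 (24 * n + 23)"
proof -
  obtain A B K1 K2 L U where eq: "Abs_fps CP3 = A + B + 8 * K1 + 8 * K2 + 16 * L + 32 * U"
    and s: "supp_mod 2 0 A" "supp_mod 4 1 B" "supp_mod 12 3 K1" "supp_mod 12 7 K2" "supp_mod 24 11 L"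
    by (rule CP3_dissection)
  have CP3: "CP3 k = fps_nth A k + fps_nth B k + 8 * fps_nth K1 k + 8 * fps_nth K2 k +
      16 * fps_nth L k + 32 * fps_nth U k" for k
    using arg_cong[OF eq, of "\<lambda>f. fps_nth f k"] by (simp add: numeral_fps_const)
  have 0: "fps_nth A k = 0" "fps_nth B k = 0" "fps_nth K1 k = 0" "fps_nth K2 k = 0" if "k mod 12 = 11" for k
  proof -
    have "k mod 2 \<noteq> 0 mod 2" "k mod 4 \<noteq> 1 mod 4" "k mod 12 \<noteq> 3 mod 12" "k mod 12 \<noteq> 7 mod 12"
      using that by presburger+
    with s show "fps_nth A k = 0" "fps_nth B k = 0" "fps_nth K1 k = 0" "fps_nth K2 k = 0"
      by (auto intro: supp_mod_nth_eq_0)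
  qed
  have "(12 * n + 11) mod 12 = 11" by presburger
  from 0[OF this] show "16 dvd CP3 (12 * n + 11)" by (simp add: CP3)
  have "(24 * n + 23) mod 12 = 11" by presburger
  note 0[OF this]
  moreover have "(24 * n + 23) mod 24 \<noteq> 11 mod 24" by simp
  then have "fps_nth L (24 * n + 23) = 0" using s(5) by (intro supp_mod_nth_eq_0)
  ultimately show "32 dvd CP3 (24 * n + 23)" by (simp add: CP3)
qed

section \<open>Combining the coprime moduli\<close>

lemma dvd_48_int: "3 dvd c \<Longrightarrow> 16 dvd c \<Longrightarrow> 48 dvd (c :: int)"
  using divides_mult[of 3 c 16] by (simp add: coprime_iff_gcd_eq_1 gcd_non_0_int)

lemma dvd_96_int: "3 dvd c \<Longrightarrow> 32 dvd c \<Longrightarrow> 96 dvd (c :: int)"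
  using divides_mult[of 3 c 32] by (simp add: coprime_iff_gcd_eq_1 gcd_non_0_int)

theorem theorem3p8:
  fixes n :: nat
  shows "[CP3 (24 * n + 11) = 0] (mod 48) \<and> [CP3 (24 * n + 23) = 0] (mod 96)"
proof -
  have eqs: "6 * (4 * n + 1) + 5 = 24 * n + 11" "6 * (4 * n + 3) + 5 = 24 * n + 23"
    "12 * (2 * n) + 11 = 24 * n + 11" by simp_all
  have "3 dvd CP3 (24 * n + 11)" "16 dvd CP3 (24 * n + 11)" "3 dvd CP3 (24 * n + 23)"
    using CP3_6n5_mod_3[of "4 * n + 1"] CP3_6n5_mod_3[of "4 * n + 3"] CP3_mod_16[of "2 * n"]
    by (simp_all only: eqs)
  then show ?thesis
    using CP3_mod_32[of n] unfolding cong_0_iff by (intro conjI dvd_48_int dvd_96_int)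
qed

end
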